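(* Let $a>1$ and $b>0$ satisfy $\dfrac{2\pi}{b\log a}<1$, and let $\Lambda=\Lambda(a,b)\subset\mathbb{D}$ be the image of the set $\{a^j(bk+i)\}_{j,k\in\mathbb{Z}}$ under the Cayley transform. Then there exists $A=A(a,b)\in H^\infty_2$ such that the differential equation $f''+Af=0$ admits a non-trivial solution (analytic in $\mathbb{D}$) whose zero-sequence is $\Lambda$, and hence this zero-sequence does not satisfy the Blaschke condition.
   Context: $\mathbb{D}$ is the open unit disc of $\mathbb{C}$. $H^\infty_2$ is the set of functions $A$ analytic in $\mathbb{D}$ with $\sup_{z\in\mathbb{D}}(1-|z|^2)^2|A(z)|<\infty$. A solution $f$ is non-trivial if $f\not\equiv0$. The Cayley transform is the conformal map from the upper half-plane onto $\mathbb{D}$, $z\mapsto (z-i)/(z+i)$; here $i$ is the imaginary unit. A sequence $\{z_n\}\subset\mathbb{D}$ satisfies the Blaschke condition if $\sum_n(1-|z_n|)<\infty$. *)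

theory Defs
  imports "HOL-Complex_Analysis.Complex_Analysis"
begin

abbreviation unit_disc :: "complex set" where
  "unit_disc \<equiv> ball 0 1"

definition H_inf_2 :: "(complex \<Rightarrow> complex) set" where
  "H_inf_2 = {A. A holomorphic_on unit_disc \<and>
     bdd_above ((\<lambda>z. (1 - (norm z)\<^sup>2)\<^sup>2 * norm (A z)) ` unit_disc)}"

definition solves_ode :: "(complex \<Rightarrow> complex) \<Rightarrow> (complex \<Rightarrow> complex) \<Rightarrow> bool" where
  "solves_ode A f \<longleftrightarrow> f holomorphic_on unit_disc \<and>
     (\<forall>z\<in>unit_disc. (deriv ^^ 2) f z + A z * f z = 0)"

definition nontrivial :: "(complex \<Rightarrow> complex) \<Rightarrow> bool" where
  "nontrivial f \<longleftrightarrow> (\<exists>z\<in>unit_disc. f z \<noteq> 0)"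

text \<open>The value of \<^term>\<open>zorder\<close> is only meaningful for functions that do not vanish
  identically near the point.\<close>

definition zero_mult :: "(complex \<Rightarrow> complex) \<Rightarrow> complex \<Rightarrow> nat" where
  "zero_mult f w = (if f w = 0 then nat (zorder f w) else 0)"

text \<open>Infinite zero-sequences in the disc: every zero is listed as often as its
  multiplicity, in an arbitrary order. The function is understood to be analytic
  and not identically zero in the disc.\<close>

definition is_zero_sequence :: "(complex \<Rightarrow> complex) \<Rightarrow> (nat \<Rightarrow> complex) \<Rightarrow> bool" where
  "is_zero_sequence f zs \<longleftrightarrow> range zs \<subseteq> unit_disc \<and>
     (\<forall>w\<in>unit_disc. finite {n. zs n = w} \<and> card {n. zs n = w} = zero_mult f w)"

definition Blaschke_condition :: "(nat \<Rightarrow> complex) \<Rightarrow> bool" where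
  "Blaschke_condition zs \<longleftrightarrow> summable (\<lambda>n. 1 - norm (zs n))"

definition cayley :: "complex \<Rightarrow> complex" where
  "cayley z = (z - \<i>) / (z + \<i>)"

definition Lambda :: "real \<Rightarrow> real \<Rightarrow> complex set" where
  "Lambda a b = cayley ` {of_real a powi j * (of_real b * of_int k + \<i>) | j k :: int. True}"

end

theory Submission
  imports Defs
begin

text \<open>In the upper half-plane put \<open>q = exp (2 * pi / b)\<close>; the hypothesis says \<open>1 < q < a\<close>. For every scale
  \<open>a\<^sup>j\<close> there is an explicit \<open>b\<close>-periodic Blaschke product with zeros \<open>b * k + \<i>\<close>, rescaled by \<open>a\<^sup>j\<close>.
  Normalised, their product over all \<open>j\<close> converges to a function \<open>F\<close> which has simple zeros exactly at the
  given lattice, satisfies \<open>F (a * z) = - F z / q\<close>, and behaves like \<open>Im z powr - \<beta>\<close> with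
  \<open>\<beta> = ln q / ln a < 1\<close>, up to the distance to the zeros.

  The function \<open>F * exp g\<close> solves an equation \<open>u'' + B * u = 0\<close> with \<open>B\<close> analytic as soon as \<open>h = g'\<close>
  takes the value \<open>- F'' / (2 * F')\<close> at every zero of \<open>F\<close>. Since \<open>\<beta> < 1\<close>, a Lagrange type series solves this
  interpolation problem with \<open>h = O(1 / Im z)\<close>, and the invariance under \<open>z \<mapsto> a * z\<close> reduces all estimates
  to one strip, where they give \<open>B = O(1 / (Im z)\<^sup>2)\<close>. The conformal map to the disc preserves both the
  form of the equation and the growth of the coefficient.

  The Blaschke sum diverges because each of the infinitely many scales \<open>a\<^sup>j\<close>, \<open>j \<le> 0\<close>, contributes at least
  a fixed amount.\<close>

subsection \<open>Growth in the upper half-plane\<close>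

text \<open>The lattice violates the Blaschke condition, so its rows cannot simply be multiplied as
  Blaschke products. Dividing each row by its limit, \<open>1 / q\<close> at
  \<open>i * infinity\<close> for the expanded arguments and \<open>- 1\<close> at \<open>0\<close>
  for the contracted ones, restores convergence. The price is the multiplier \<open>- 1 / q\<close>,
  which amounts to growth of order \<beta>, and \<beta> is the quantity
  \<open>2 * pi / (b * ln a)\<close> assumed to be below 1.

  With \<open>h = g'\<close> one has
  \<open>(F * exp g)'' = (F'' + 2 * F' * h + F * (h' + h^2)) * exp g\<close>, hence
  \<open>B = - (F'' + 2 * F' * h) / F - h' - h^2\<close>. Only the first quotient can have poles,
  and since the zeros of \<open>F\<close> are simple it is analytic once its numerator vanishes at
  them; this is the interpolation condition.

  The rows can be interpolated one at a time: the Lagrange terms are built from the full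
  \<open>F\<close>, not from the factor of their own row, so they vanish on all other rows. The sum
  over the rows is then the sum of rescaled copies of a single function.\<close>

abbreviation uhp :: "complex set" where
  "uhp \<equiv> {z. 0 < Im z}"

lemma open_uhp: "open uhp"
  by (simp add: open_halfspace_Im_gt)

lemma convex_uhp: "convex uhp"
  by (simp add: convex_halfspace_Im_gt)

text \<open>In height, a closed fundamental domain for multiplication by \<open>a\<close>,
  logarithmically centred at 1. Of all the rows of the lattice, at heights \<open>a powi j\<close>,
  it contains only the one at height 1.\<close>

definition central_strip :: "real \<Rightarrow> complex set" where
  "central_strip a = {z. 1 / sqrt a \<le> Im z \<and> Im z \<le> sqrt a}"

lemma central_strip_subset_uhp: "a > 1 \<Longrightarrow> central_strip a \<subseteq> uhp"
  unfolding central_strip_def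
  by (auto intro: less_le_trans[of 0 "1 / sqrt a"])

lemma convex_central_strip: "convex (central_strip a)"
proof -
  have "central_strip a = {z. Im z \<ge> 1 / sqrt a} \<inter> {z. Im z \<le> sqrt a}"
    by (auto simp: central_strip_def)
  then show ?thesis
    by (simp add: convex_Int convex_halfspace_Im_ge convex_halfspace_Im_le)
qed

definition growth :: "real \<Rightarrow> (complex \<Rightarrow> complex) \<Rightarrow> bool" where
  "growth s f \<longleftrightarrow> (\<exists>C. \<forall>z\<in>uhp. norm (f z) \<le> C * Im z powr (- s))"

lemma growthI: "(\<And>z. Im z > 0 \<Longrightarrow> norm (f z) \<le> C * Im z powr (- s)) \<Longrightarrow> growth s f"
  by (auto simp: growth_def)

lemma growthE:
  assumes "growth s f"
  obtains C where "C > 0" "\<And>z. Im z > 0 \<Longrightarrow> norm (f z) \<le> C * Im z powr (- s)"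
proof -
  from assms obtain C where C: "\<And>z. Im z > 0 \<Longrightarrow> norm (f z) \<le> C * Im z powr (- s)"
    by (auto simp: growth_def)
  show ?thesis
  proof (rule that[of "max 1 C"])
    fix z :: complex assume "Im z > 0"
    then show "norm (f z) \<le> max 1 C * Im z powr (- s)"
      by (intro order_trans[OF C] mult_right_mono) auto
  qed simp
qed

lemma growth_add: "growth s f \<Longrightarrow> growth s g \<Longrightarrow> growth s (\<lambda>z. f z + g z)"
proof (elim growthE)
  fix C D assume *: "\<And>z. Im z > 0 \<Longrightarrow> norm (f z) \<le> C * Im z powr (- s)"
    "\<And>z. Im z > 0 \<Longrightarrow> norm (g z) \<le> D * Im z powr (- s)"
  show "growth s (\<lambda>z. f z + g z)"
  proof (rule growthI)
    fix z assume "Im z > 0"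
    from *[OF this] show "norm (f z + g z) \<le> (C + D) * Im z powr (- s)"
      by (simp add: distrib_right norm_triangle_le)
  qed
qed

lemma growth_mult: "growth s f \<Longrightarrow> growth t g \<Longrightarrow> growth (s + t) (\<lambda>z. f z * g z)"
proof (elim growthE)
  fix C D :: real assume *: "\<And>z. Im z > 0 \<Longrightarrow> norm (f z) \<le> C * Im z powr (- s)"
    "\<And>z. Im z > 0 \<Longrightarrow> norm (g z) \<le> D * Im z powr (- t)" "C > 0" "D > 0"
  show "growth (s + t) (\<lambda>z. f z * g z)"
  proof (rule growthI)
    fix z assume z: "Im z > 0"
    have "norm (f z * g z) \<le> (C * Im z powr (- s)) * (D * Im z powr (- t))"
      unfolding norm_mult using * z by (intro mult_mono) auto
    also have "\<dots> = (C * D) * Im z powr (- (s + t))"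
      using z by (simp add: powr_add powr_diff powr_minus field_simps)
    finally show "norm (f z * g z) \<le> (C * D) * Im z powr (- (s + t))" .
  qed
qed

lemma growth_cmult: "growth s f \<Longrightarrow> growth s (\<lambda>z. c * f z)"
proof (elim growthE)
  fix C :: real assume *: "\<And>z. Im z > 0 \<Longrightarrow> norm (f z) \<le> C * Im z powr (- s)"
  show "growth s (\<lambda>z. c * f z)"
  proof (rule growthI)
    fix z assume "Im z > 0"
    from *[OF this] show "norm (c * f z) \<le> (norm c * C) * Im z powr (- s)"
      unfolding norm_mult mult.assoc by (intro mult_left_mono) auto
  qed
qed

text \<open>Cauchy's estimate on the circle of radius \<open>Im z / 2\<close>: the circle stays
  above height \<open>Im z / 2\<close>, and for \<open>s \<ge> 0\<close> the bound on
  \<open>f\<close> is worst at the lowest height.\<close>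

lemma growth_deriv:
  assumes "growth s f" "f holomorphic_on uhp" "s \<ge> 0"
  shows "growth (s + 1) (deriv f)"
proof -
  obtain C where C: "C > 0" "\<And>z. Im z > 0 \<Longrightarrow> norm (f z) \<le> C * Im z powr (- s)"
    using growthE[OF assms(1)] by metis
  show ?thesis
  proof (rule growthI)
    fix z assume z: "Im z > 0"
    define r where "r = Im z / 2"
    have r: "r > 0" using z by (simp add: r_def)
    have Im_ge: "Im w \<ge> r" if "dist z w \<le> r" for w
    proof -
      have "\<bar>Im (z - w)\<bar> \<le> r"
        using abs_Im_le_cmod[of "z - w"] that by (simp add: dist_norm)
      then show ?thesis unfolding r_def minus_complex.sel by linarith
    qed
    have sub: "cball z r \<subseteq> uhp" using Im_ge r by force
    have "norm ((deriv ^^ 1) f z) \<le> fact 1 * (C * r powr (- s)) / r ^ 1"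
    proof (rule Cauchy_inequality)
      show "f holomorphic_on ball z r" "continuous_on (cball z r) f"
        using assms(2) sub ball_subset_cball
        by (blast intro: holomorphic_on_subset holomorphic_on_imp_continuous_on)+
      fix w assume "norm (z - w) = r"
      then have w: "Im w \<ge> r" by (intro Im_ge) (simp add: dist_norm)
      have "norm (f w) \<le> C * Im w powr (- s)" using w r by (intro C) auto
      also have "\<dots> \<le> C * r powr (- s)"
        using w r C(1) assms(3) by (intro mult_left_mono powr_mono2') auto
      finally show "norm (f w) \<le> C * r powr (- s)" .
    qed (fact r)
    also have "\<dots> = C * r powr (- (s + 1))"
      using r by (simp add: powr_minus powr_add powr_diff field_simps)
    also have "r powr (- (s + 1)) = (1/2) powr (- (s + 1)) * Im z powr (- (s + 1))"
      using z by (simp add: r_def flip: powr_mult)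
    finally show "norm (deriv f z) \<le> (C * (1/2) powr (- (s + 1))) * Im z powr (- (s + 1))"
      by simp
  qed
qed

text \<open>A negative power is undone by the opposite positive one, for which induction works. The
  codomain is an arbitrary field so that functions and their norms are both covered.\<close>

lemma scaling_powi:
  fixes g :: "complex \<Rightarrow> 'a :: field"
  assumes "a > (0::real)" and c: "c \<noteq> 0"
    and g: "\<And>z. Im z > 0 \<Longrightarrow> g (of_real a * z) = c * g z" and "Im z > 0"
  shows "g (of_real a powi m * z) = c powi m * g z"
proof -
  have up: "g (of_real a powi m * z) = c powi m * g z" if "m \<ge> 0" "Im z > 0" for m z
    using that
  proof (induction m arbitrary: z rule: int_ge_induct)
    case (step i)
    have "of_real a powi (i + 1) * z = of_real a powi i * (of_real a * z)"
      using assms(1) by (simp add: power_int_add)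
    then have "g (of_real a powi (i + 1) * z) = c powi i * g (of_real a * z)"
      by (simp only:) (use step assms(1) in simp)
    also have "\<dots> = c powi (i + 1) * g z"
      using step c by (simp add: g power_int_add)
    finally show ?case .
  qed simp
  show ?thesis
  proof (cases "m \<ge> 0")
    case False
    define w where "w = of_real a powi m * z"
    have im: "Im w > 0"
      using assms by (simp add: w_def flip: of_real_power_int)
    have "g (of_real a powi (-m) * w) = c powi (-m) * g w"
      using False im by (intro up) auto
    moreover have "of_real a powi (-m) * w = z"
      using assms(1) by (simp add: w_def power_int_minus field_simps)
    ultimately show ?thesis
      using c by (simp add: w_def power_int_minus field_simps)
  qed (use up assms in auto)
qed

lemma scale_to_central_strip:
  assumes "a > (1::real)" "Im z > 0"
  obtains m w where "w \<in> central_strip a" "z = of_real a powi m * w"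
proof -
  \<comment> \<open>Rounding \<open>log a (Im z)\<close> to a nearest integer leaves an exponent
    between -1/2 and 1/2.\<close>
  define m where "m = \<lfloor>log a (Im z) + 1/2\<rfloor>"
  define w where "w = of_real (a powi (-m)) * z"
  have "Im w = a powi (-m) * Im z"
    unfolding w_def times_complex.sel by (simp only: Re_complex_of_real Im_complex_of_real)
  then have Imw: "Im w = a powr (log a (Im z) - of_int m)"
    using assms by (simp add: powr_diff powr_real_of_int' power_int_minus divide_simps)
  have "log a (Im z) - m \<ge> -1/2" "log a (Im z) - m \<le> 1/2"
    unfolding m_def by linarith+
  then have "a powr (-1/2) \<le> Im w" "Im w \<le> a powr (1/2)"
    unfolding Imw using assms by (intro powr_mono; simp)+
  then have "w \<in> central_strip a"
    using assms powr_minus_divide[of a "1/2"] by (simp add: central_strip_def powr_half_sqrt)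
  moreover have "z = of_real a powi m * w"
    using assms by (simp add: w_def power_int_minus field_simps)
  ultimately show ?thesis by (rule that)
qed

lemma Im_central_strip_powr_le:
  assumes "a > 1" "w \<in> central_strip a"
  shows "Im w powr s \<le> a powr (\<bar>s\<bar> / 2)"
proof -
  have w: "Im w > 0" using assms central_strip_subset_uhp by auto
  have "\<bar>ln (Im w)\<bar> \<le> ln a / 2"
  proof -
    have "ln (Im w) \<le> ln (sqrt a)" "ln (1 / sqrt a) \<le> ln (Im w)"
      using assms w by (auto simp: central_strip_def)
    then show ?thesis using assms by (simp add: ln_div ln_sqrt)
  qed
  then have "\<bar>s * ln (Im w)\<bar> \<le> \<bar>s\<bar> * (ln a / 2)"
    unfolding abs_mult by (intro mult_left_mono) auto
  then show ?thesis
    using w assms by (auto simp: powr_def)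
qed

text \<open>The multiplier \<open>a powr (- s)\<close> per scale accumulates to
  \<open>(Im z / Im w) powr (- s)\<close>, so a bound on one fundamental domain spreads over the
  whole half-plane.\<close>

lemma growth_scaling:
  assumes a: "a > 1"
    and f: "\<And>z. Im z > 0 \<Longrightarrow> norm (f (of_real a * z)) = a powr (- s) * norm (f z)"
    and bd: "\<And>z. z \<in> central_strip a \<Longrightarrow> norm (f z) \<le> C"
  shows "growth s f"
proof (rule growthI)
  fix z assume z: "Im z > 0"
  obtain m w where w: "w \<in> central_strip a" and zw: "z = of_real a powi m * w"
    using scale_to_central_strip[OF a z] by metis
  have Imw: "Im w > 0" using w central_strip_subset_uhp[OF a] by auto
  have zw': "Im z = a powi m * Im w"
    using zw by (simp flip: of_real_power_int)
  have "norm (f z) = (a powr (- s)) powi m * norm (f w)"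
    unfolding zw using a Imw by (intro scaling_powi[of a _ "\<lambda>z. norm (f z)"] f) auto
  also have "(a powr (- s)) powi m = Im z powr (- s) * Im w powr s"
  proof -
    have "(a powr (- s)) powi m = (a powi m) powr (- s)"
      using a by (simp add: powr_powr mult_ac flip: powr_real_of_int')
    then show ?thesis
      using a Imw by (simp add: zw' powr_mult powr_minus)
  qed
  also have "Im z powr (- s) * Im w powr s * norm (f w)
     \<le> Im z powr (- s) * a powr (\<bar>s\<bar> / 2) * \<bar>C\<bar>"
    using bd[OF w] Im_central_strip_powr_le[OF a w, of s]
    by (intro mult_mono) auto
  finally show "norm (f z) \<le> (a powr (\<bar>s\<bar> / 2) * \<bar>C\<bar>) * Im z powr (- s)"
    by (simp add: mult_ac)
qed

lemma growth_bounded_central_strip: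
  assumes "a > 1" "growth s f"
  obtains C where "C > 0" "\<And>z. z \<in> central_strip a \<Longrightarrow> norm (f z) \<le> C"
proof -
  obtain C where C: "C > 0" "\<And>z. Im z > 0 \<Longrightarrow> norm (f z) \<le> C * Im z powr (- s)"
    using growthE[OF assms(2)] by metis
  show ?thesis
  proof (rule that[of "C * a powr (\<bar>s\<bar> / 2)"])
    fix z assume z: "z \<in> central_strip a"
    then have "norm (f z) \<le> C * Im z powr (- s)"
      using central_strip_subset_uhp[OF assms(1)] by (intro C) auto
    also have "\<dots> \<le> C * a powr (\<bar>s\<bar> / 2)"
      using Im_central_strip_powr_le[OF assms(1) z, of "-s"] C(1)
      by (intro mult_left_mono) auto
    finally show "norm (f z) \<le> C * a powr (\<bar>s\<bar> / 2)" .
  qed (use C assms in auto)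
qed

text \<open>The strip is convex and the derivative is bounded there. This will bound a numerator by
  the distance to a zero that it shares with its denominator.\<close>

lemma growth_lipschitz_central_strip:
  assumes "a > 1" "growth s f" "f holomorphic_on uhp" "s \<ge> 0"
  obtains C where "C > 0" "\<And>z w. z \<in> central_strip a \<Longrightarrow> w \<in> central_strip a \<Longrightarrow>
    norm (f z - f w) \<le> C * norm (z - w)"
proof -
  obtain C where C: "C > 0" "\<And>z. z \<in> central_strip a \<Longrightarrow> norm (deriv f z) \<le> C"
    using growth_bounded_central_strip[OF assms(1) growth_deriv[OF assms(2,3,4)]] by metis
  show ?thesis
  proof (rule that[OF C(1)])
    fix z w assume "z \<in> central_strip a" "w \<in> central_strip a"
    then show "norm (f z - f w) \<le> C * norm (z - w)"
    proof (intro field_differentiable_bound[OF convex_central_strip])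
      fix x assume x: "x \<in> central_strip a"
      then have "x \<in> uhp" using central_strip_subset_uhp assms(1) by blast
      then show "(f has_field_derivative deriv f x) (at x within central_strip a)"
        using assms(3) open_uhp holomorphic_derivI by metis
    qed (use C in auto)
  qed
qed

section \<open>Series of analytic functions, rescaled derivatives, removable singularities\<close>

lemma holomorphic_infsum:
  fixes f :: "'i \<Rightarrow> complex \<Rightarrow> complex"
  assumes hol: "\<And>k. f k holomorphic_on A"
    and dom: "\<And>z. z \<in> A \<Longrightarrow> \<exists>r>0. \<exists>M. ball z r \<subseteq> A \<and> M summable_on UNIV \<and>
        (\<forall>k. \<forall>w\<in>ball z r. norm (f k w) \<le> M k)"
  shows "(\<lambda>z. \<Sum>\<^sub>\<infinity>k. f k z) holomorphic_on A"
proof -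
  have "(\<lambda>z. \<Sum>\<^sub>\<infinity>k. f k z) field_differentiable at z" if z: "z \<in> A" for z
  proof -
    obtain r M where r: "r > 0" "ball z r \<subseteq> A" "M summable_on UNIV"
      and M: "\<And>k w. w \<in> ball z r \<Longrightarrow> norm (f k w) \<le> M k"
      using dom[OF z] by metis
    have sub: "cball z (r / 2) \<subseteq> ball z r" using r by (auto simp: subset_iff)
    have lim: "uniform_limit (cball z (r/2)) (\<lambda>X w. \<Sum>k\<in>X. f k w) (\<lambda>w. \<Sum>\<^sub>\<infinity>k. f k w)
       (finite_subsets_at_top UNIV)"
      using M sub r(3) by (intro Weierstrass_m_test_general[where M = M]) blast+
    have h: "(\<lambda>w. \<Sum>k\<in>X. f k w) holomorphic_on A" for X
      by (intro holomorphic_intros hol)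
    have "(\<lambda>w. \<Sum>\<^sub>\<infinity>k. f k w) holomorphic_on ball z (r/2)"
    proof (rule holomorphic_uniform_limit[OF _ lim])
      show "\<forall>\<^sub>F X in finite_subsets_at_top UNIV.
          continuous_on (cball z (r/2)) (\<lambda>w. \<Sum>k\<in>X. f k w) \<and>
          (\<lambda>w. \<Sum>k\<in>X. f k w) holomorphic_on ball z (r/2)"
      proof (intro always_eventually allI conjI)
        fix X
        show "continuous_on (cball z (r/2)) (\<lambda>w. \<Sum>k\<in>X. f k w)"
          using sub r(2) by (intro holomorphic_on_imp_continuous_on holomorphic_on_subset[OF h]) blast
        show "(\<lambda>w. \<Sum>k\<in>X. f k w) holomorphic_on ball z (r/2)"
          using sub r(2) ball_subset_cball by (intro holomorphic_on_subset[OF h]) blast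
      qed
    qed simp
    then show ?thesis
      using r by (intro holomorphic_on_imp_differentiable_at[of _ "ball z (r/2)"]) auto
  qed
  then show ?thesis
    by (auto simp: holomorphic_on_def intro: field_differentiable_at_within)
qed

lemma infsum_dominated:
  fixes f :: "'i \<Rightarrow> complex"
  assumes "\<And>k. norm (f k) \<le> M k" "M summable_on UNIV"
  shows "norm (\<Sum>\<^sub>\<infinity>k. f k) \<le> (\<Sum>\<^sub>\<infinity>k. M k)"
proof -
  have "f summable_on UNIV"
    by (rule abs_summable_summable, rule Infinite_Sum.abs_summable_on_comparison_test'[OF assms(2)])
       (use assms in auto)
  then show ?thesis
    using assms by (intro norm_infsum_le[OF has_sum_infsum has_sum_infsum]) auto
qed

lemma summable_on_int:
  fixes f :: "int \<Rightarrow> real"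
  assumes "\<And>k. f k \<ge> 0" "summable (\<lambda>n. f (int n))" "summable (\<lambda>n. f (- int n))"
  shows "f summable_on UNIV"
proof -
  have 1: "f summable_on range int"
    using summable_nonneg_imp_summable_on[OF assms(2)] assms(1)
    by (subst summable_on_reindex) (auto simp: o_def)
  have "f summable_on range (\<lambda>n. - int n)"
    using summable_nonneg_imp_summable_on[OF assms(3)] assms(1)
    by (subst summable_on_reindex) (auto simp: o_def inj_on_def)
  \<comment> \<open>The index 0 lies in both ranges and is removed from the second.\<close>
  then have 2: "f summable_on (range (\<lambda>n. - int n) - range int)"
    by (rule summable_on_subset_banach) auto
  have "f summable_on (range int \<union> (range (\<lambda>n. - int n) - range int))"
    by (rule summable_on_Un_disjoint[OF 1 2]) auto
  also have "range int \<union> (range (\<lambda>n. - int n) - range int) = UNIV"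
  proof -
    have "k \<in> range int \<union> range (\<lambda>n. - int n)" for k
      by (cases k rule: int_cases2) auto
    then show ?thesis by blast
  qed
  finally show ?thesis .
qed

lemma deriv_scale:
  assumes "f holomorphic_on uhp" "a > 0"
    and f: "\<And>z. Im z > 0 \<Longrightarrow> f (of_real a * z) = c * f z" and z: "Im z > 0"
  shows "deriv f (of_real a * z) = c / of_real a * deriv f z"
proof -
  have az: "of_real a * z \<in> uhp" using assms by simp
  have "((\<lambda>w. f (of_real a * w)) has_field_derivative deriv f (of_real a * z) * of_real a) (at z)"
    by (rule DERIV_chain2[where g = "\<lambda>w. of_real a * w", OF holomorphic_derivI[OF assms(1) open_uhp az]])
       (auto intro!: derivative_eq_intros)
  moreover have "((\<lambda>w. f (of_real a * w)) has_field_derivative c * deriv f z) (at z)"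
  proof (rule has_field_derivative_transform_within_open[OF _ open_uhp])
    show "((\<lambda>w. c * f w) has_field_derivative c * deriv f z) (at z)"
      using z by (intro DERIV_cmult holomorphic_derivI[OF assms(1) open_uhp]) auto
  qed (use f z in auto)
  ultimately have "deriv f (of_real a * z) * of_real a = c * deriv f z"
    by (rule DERIV_unique)
  then show ?thesis using assms(2) by (simp add: field_simps)
qed

text \<open>The quotient \<open>P / F\<close> with the removable singularities at common simple
  zeros filled in by l'Hopital's rule.\<close>

definition zero_quotient :: "(complex \<Rightarrow> complex) \<Rightarrow> (complex \<Rightarrow> complex) \<Rightarrow> complex \<Rightarrow> complex" where
  "zero_quotient P F z = (if F z = 0 then deriv P z / deriv F z else P z / F z)"

text \<open>Near a zero \<open>w\<close> the quotient equals \<open>p / f\<close> for the analytic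
  difference quotients \<open>p\<close> and \<open>f\<close>. Where \<open>f\<close> is nonzero,
  \<open>F\<close> has no zero other than \<open>w\<close>, so both branches of the definition agree
  with \<open>p / f\<close> there.\<close>

lemma holomorphic_zero_quotient:
  assumes "open A" "P holomorphic_on A" "F holomorphic_on A"
    and zero: "\<And>z. z \<in> A \<Longrightarrow> F z = 0 \<Longrightarrow> P z = 0 \<and> deriv F z \<noteq> 0"
  shows "zero_quotient P F holomorphic_on A"
proof -
  have "zero_quotient P F field_differentiable at w" if w: "w \<in> A" for w
  proof (cases "F w = 0")
    case False
    define B where "B = A \<inter> F -` (- {0})"
    have "open B"
      unfolding B_def using assms
      by (intro continuous_open_preimage holomorphic_on_imp_continuous_on) auto
    moreover have "(\<lambda>z. P z / F z) holomorphic_on B"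
      using assms by (intro holomorphic_intros) (auto simp: B_def elim: holomorphic_on_subset)
    then have "zero_quotient P F holomorphic_on B"
      by (rule holomorphic_transform) (auto simp: B_def zero_quotient_def)
    ultimately show ?thesis
      using False w by (auto simp: B_def intro: holomorphic_on_imp_differentiable_at)
  next
    case True
    define p where "p = (\<lambda>z. if z = w then deriv P w else (P z - P w) / (z - w))"
    define f where "f = (\<lambda>z. if z = w then deriv F w else (F z - F w) / (z - w))"
    have hol: "p holomorphic_on A" "f holomorphic_on A"
      unfolding p_def f_def using assms by (auto intro: pole_lemma_open)
    define B where "B = A \<inter> f -` (- {0})"
    have "open B"
      unfolding B_def using assms hol
      by (intro continuous_open_preimage holomorphic_on_imp_continuous_on) auto
    moreover have "(\<lambda>z. p z / f z) holomorphic_on B"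
      using hol by (intro holomorphic_intros) (auto simp: B_def elim: holomorphic_on_subset)
    then have "zero_quotient P F holomorphic_on B"
    proof (rule holomorphic_transform)
      fix z assume z: "z \<in> B"
      show "p z / f z = zero_quotient P F z"
        using z zero[OF w] True by (auto simp: B_def zero_quotient_def p_def f_def)
    qed
    moreover have "w \<in> B" using w zero[OF w True] by (auto simp: B_def f_def)
    ultimately show ?thesis
      by (auto intro: holomorphic_on_imp_differentiable_at)
  qed
  then show ?thesis
    by (auto simp: holomorphic_on_def intro: field_differentiable_at_within)
qed

lemma half_ball_bounds:
  assumes "Im z > 0" "w \<in> ball z (Im z / 2)"
  shows "Im w \<ge> Im z / 2" "\<bar>Re w\<bar> \<le> norm z + Im z / 2" "w \<in> uhp"
proof -
  have d: "norm (z - w) \<le> Im z / 2" using assms(2) by (simp add: dist_norm)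
  show "Im w \<ge> Im z / 2"
    using d abs_Im_le_cmod[of "z - w"] unfolding minus_complex.sel by linarith
  then show "w \<in> uhp" using assms(1) by simp
  have "norm w \<le> norm z + norm (z - w)"
    using norm_triangle_ineq4[of z "z - w"] by simp
  then show "\<bar>Re w\<bar> \<le> norm z + Im z / 2"
    using d abs_Re_le_cmod[of w] by linarith
qed

lemma half_ball_subset: "Im z > 0 \<Longrightarrow> ball z (Im z / 2) \<subseteq> uhp"
  using half_ball_bounds(3) by blast

subsection \<open>The generating function of the lattice\<close>

text \<open>Mean value inequality on the left half-plane, where the derivative of \<open>exp\<close>
  has norm at most 1.\<close>

lemma norm_one_minus_exp_le:
  fixes w :: complex
  assumes "Re w \<le> 0"
  shows "norm (1 - exp w) \<le> norm w"
proof -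
  have "norm (exp w - exp 0) \<le> 1 * norm (w - 0)"
  proof (rule field_differentiable_bound[of "{w. Re w \<le> 0}" _ exp])
    show "convex {w. Re w \<le> 0}" by (rule convex_halfspace_Re_le)
    fix z :: complex assume "z \<in> {w. Re w \<le> 0}"
    then show "(exp has_field_derivative exp z) (at z within {w. Re w \<le> 0})" "norm (exp z) \<le> 1"
      by (auto intro: derivative_eq_intros)
  qed (use assms in auto)
  then show ?thesis by (simp add: norm_minus_commute)
qed

text \<open>The entire function \<open>(exp z - 1) / z\<close> vanishes only at the nonzero
  multiples of \<open>2 * pi * i\<close>, all outside the closed box; compactness of the box gives
  the constant.\<close>

lemma norm_one_minus_exp_ge:
  fixes R :: real
  obtains c where "c > 0"
    "\<And>w :: complex. \<bar>Re w\<bar> \<le> R \<Longrightarrow> \<bar>Im w\<bar> \<le> pi \<Longrightarrow> c * norm w \<le> norm (1 - exp w)"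
proof -
  define g :: "complex \<Rightarrow> complex" where
    "g = (\<lambda>z. if z = 0 then deriv exp 0 else (exp z - exp 0) / (z - 0))"
  define B where "B = cbox (Complex (-R) (-pi)) (Complex R pi)"
  have B: "w \<in> B \<longleftrightarrow> \<bar>Re w\<bar> \<le> R \<and> \<bar>Im w\<bar> \<le> pi" for w
    by (auto simp: B_def in_cbox_complex_iff)
  have d: "deriv exp (0::complex) = 1"
    by (rule DERIV_imp_deriv) (auto intro: derivative_eq_intros)
  have "g holomorphic_on UNIV"
    unfolding g_def by (rule pole_lemma_open) (auto intro: holomorphic_intros)
  then have "continuous_on B g"
    using holomorphic_on_imp_continuous_on continuous_on_subset by blast
  then have comp: "compact (g ` B)"
    by (intro compact_continuous_image) (auto simp: B_def)
  have "0 \<notin> g ` B"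
  proof
    assume "0 \<in> g ` B"
    then obtain w where w: "w \<in> B" "g w = 0" by auto
    have "w \<noteq> 0" using w d by (auto simp: g_def)
    with w have "exp w = 1" by (simp add: g_def)
    then obtain n :: int where n: "Re w = 0" "Im w = of_int (2 * n) * pi"
      unfolding exp_eq_1 by auto
    have "\<bar>of_int (2 * n)\<bar> * pi \<le> 1 * pi"
      using w(1) n(2) by (simp add: B abs_mult)
    then have "\<bar>2 * real_of_int n\<bar> \<le> 1"
      by (simp add: mult_le_cancel_right1)
    then have "n = 0" by linarith
    with n \<open>w \<noteq> 0\<close> show False by (simp add: complex_eq_iff)
  qed
  then obtain c where c: "c > 0" "\<And>x. x \<in> g ` B \<Longrightarrow> c \<le> norm x"
    using separate_point_closed[OF compact_imp_closed[OF comp], of 0] by (auto simp: dist_norm)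
  show ?thesis
  proof (rule that[OF c(1)])
    fix w assume "\<bar>Re w\<bar> \<le> R" "\<bar>Im w\<bar> \<le> pi"
    then have "c \<le> norm (g w)" by (intro c) (simp add: B)
    then show "c * norm w \<le> norm (1 - exp w)"
      by (cases "w = 0") (auto simp: g_def norm_divide field_simps norm_minus_commute)
  qed
qed

locale cayley_lattice =
  fixes a b :: real
  assumes a_gt_1: "a > 1" and b_pos: "b > 0" and density: "exp (2 * pi / b) < a"
begin

text \<open>\<open>1 / q\<close> is the common value of \<open>nome\<close> at all the
  nodes.\<close>

definition q :: real where
  "q = exp (2 * pi / b)"

definition nome :: "complex \<Rightarrow> complex" where
  "nome z = exp (2 * of_real pi * \<i> * z / of_real b)"

definition node :: "int \<Rightarrow> complex" where
  "node k = of_real b * of_int k + \<i>"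

text \<open>Up to a unimodular constant, this is the Blaschke product of the half-plane with zeros
  \<^term>\<open>node k\<close>; it tends to \<open>1 / q\<close> at \<open>\<i> \<infinity>\<close> and equals \<open>- 1\<close> at \<open>0\<close>.\<close>

definition row_factor :: "complex \<Rightarrow> complex" where
  "row_factor z = (1 - of_real q * nome z) / (of_real q - nome z)"

lemma q_gt_1: "q > 1"
  using b_pos by (simp add: q_def)

lemma norm_nome: "norm (nome z) = exp (- (2 * pi * Im z / b))"
  using b_pos by (simp add: nome_def)

lemma norm_nome_less_1: "Im z > 0 \<Longrightarrow> norm (nome z) < 1"
  using b_pos by (simp add: norm_nome)

lemma norm_q_minus_nome:
  assumes "Im z > 0"
  shows "norm (of_real q - nome z) \<ge> q - norm (nome z)" "norm (of_real q - nome z) \<ge> q - 1"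
    "norm (of_real q - nome z) > 0"
proof -
  show "norm (of_real q - nome z) \<ge> q - norm (nome z)"
    using norm_triangle_ineq2[of "of_real q" "nome z"] q_gt_1 by simp
  then show "norm (of_real q - nome z) \<ge> q - 1" "norm (of_real q - nome z) > 0"
    using norm_nome_less_1[OF assms] q_gt_1 by linarith+
qed

lemma q_minus_nome_nonzero: "Im z > 0 \<Longrightarrow> of_real q - nome z \<noteq> 0"
  using norm_q_minus_nome(3) by force

lemma holomorphic_row [holomorphic_intros]:
  assumes "f holomorphic_on A" "\<And>z. z \<in> A \<Longrightarrow> Im (f z) > 0"
  shows "(\<lambda>z. row_factor (f z)) holomorphic_on A"
  unfolding row_factor_def using assms q_minus_nome_nonzero b_pos unfolding nome_def
  by (intro holomorphic_intros) auto

text \<open>With \<open>e = nome z\<close>, the difference \<open>|q - e|^2 - |1 - q * e|^2\<close>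
  factors as \<open>(q^2 - 1) * (1 - |e|^2)\<close>.\<close>

lemma norm_row_le_1:
  assumes "Im z > 0"
  shows "norm (row_factor z) \<le> 1"
proof -
  define e where "e = nome z"
  have "(norm (1 - of_real q * e))\<^sup>2 \<le> (norm (of_real q - e))\<^sup>2"
  proof -
    have e: "(Re e)\<^sup>2 + (Im e)\<^sup>2 \<le> 1"
      using norm_nome_less_1[OF assms] unfolding e_def cmod_power2[symmetric]
      by (simp add: power_le_one)
    have "(q\<^sup>2 - 1) * (1 - ((Re e)\<^sup>2 + (Im e)\<^sup>2)) \<ge> 0"
      using e q_gt_1 by (intro mult_nonneg_nonneg) (auto simp: one_le_power)
    then show ?thesis
      unfolding cmod_power2 by (simp add: power2_eq_square algebra_simps)
  qed
  then have "norm (1 - of_real q * e) \<le> norm (of_real q - e)"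
    by (rule power2_le_imp_le) simp
  then show ?thesis
    using norm_q_minus_nome(3)[OF assms] by (simp add: row_factor_def norm_divide e_def)
qed

text \<open>Recentring at a node: the factor \<open>q\<close> absorbs its height and periodicity
  removes \<open>k\<close>. As \<open>k\<close> is free, the nearest node can be taken.\<close>

lemma nome_node: "of_real q * nome z = exp (2 * of_real pi * \<i> * (z - node k) / of_real b)"
proof -
  have "2 * of_real pi * \<i> * (z - node k) / of_real b =
     2 * of_real pi * \<i> * z / of_real b + of_real (2 * pi / b) - 2 * of_int k * of_real pi * \<i>"
    using b_pos by (simp add: node_def field_simps)
  also have "exp \<dots> = nome z * of_real q / exp (2 * of_int k * of_real pi * \<i>)"
    by (simp only: exp_diff exp_add exp_of_real nome_def q_def)
  also have "exp (2 * of_int k * of_real pi * \<i>) = 1"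
    using exp_eq_1 by fastforce
  finally show ?thesis by simp
qed

lemma row_node: "row_factor (node k) = 0"
  using nome_node[of "node k" k] by (simp add: row_factor_def)

text \<open>In the coordinate \<open>w\<close> of \<open>nome_node\<close>, lying within
  \<open>b / 2\<close> of a node horizontally means \<open>|Im w| \<le> pi\<close>, and the strip
  bounds \<open>Re w\<close>; so \<open>norm_one_minus_exp_ge\<close> applies to the numerator,
  while the denominator is at most \<open>q + 1\<close>.\<close>

lemma row_lower_bound:
  obtains c where "c > 0" "\<And>z k. z \<in> central_strip a \<Longrightarrow> \<bar>Re z - b * of_int k\<bar> \<le> b / 2 \<Longrightarrow>
     c * norm (z - node k) \<le> norm (row_factor z)"
proof -
  obtain c where c: "c > 0" "\<And>w :: complex. \<bar>Re w\<bar> \<le> 2 * pi * (sqrt a + 1) / b \<Longrightarrow> \<bar>Im w\<bar> \<le> pi \<Longrightarrow>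
      c * norm w \<le> norm (1 - exp w)"
    using norm_one_minus_exp_ge by metis
  show ?thesis
  proof (rule that[of "c * (2 * pi / b) / (q + 1)"])
    show "c * (2 * pi / b) / (q + 1) > 0"
      using c(1) q_gt_1 b_pos by simp
    fix z k assume z: "z \<in> central_strip a" and k: "\<bar>Re z - b * of_int k\<bar> \<le> b / 2"
    have im: "Im z > 0" using z central_strip_subset_uhp[OF a_gt_1] by auto
    define w where "w = 2 * of_real pi * \<i> * (z - node k) / of_real b"
    have "\<bar>Im z - 1\<bar> \<le> sqrt a + 1"
      using z im by (auto simp: central_strip_def)
    then have "2 * pi / b * \<bar>Im z - 1\<bar> \<le> 2 * pi / b * (sqrt a + 1)"
      using b_pos by (intro mult_left_mono) auto
    moreover have "Re w = - (2 * pi / b * (Im z - 1))"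
      using b_pos by (simp add: w_def node_def field_simps)
    ultimately have re: "\<bar>Re w\<bar> \<le> 2 * pi * (sqrt a + 1) / b"
      using b_pos by (simp add: abs_mult)
    have "2 * pi / b * \<bar>Re z - b * of_int k\<bar> \<le> 2 * pi / b * (b / 2)"
      using b_pos k by (intro mult_left_mono) auto
    then have "\<bar>Im w\<bar> \<le> pi"
      using b_pos by (simp add: w_def node_def abs_mult abs_divide)
    then have 1: "c * norm w \<le> norm (1 - of_real q * nome z)"
      using c(2)[of w] re by (simp add: nome_node[of _ k] w_def)
    have nw: "norm w = 2 * pi / b * norm (z - node k)"
      using b_pos by (simp add: w_def norm_mult norm_divide)
    have le: "norm (of_real q - nome z) \<le> q + 1"
      using norm_triangle_ineq4[of "of_real q" "nome z"] norm_nome_less_1[OF im] q_gt_1 by simp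
    have "c * norm w / (q + 1) \<le> norm (1 - of_real q * nome z) / norm (of_real q - nome z)"
      by (rule frac_le[OF _ 1 _ le]) (use norm_q_minus_nome(3)[OF im] in simp_all)
    also have "c * norm w / (q + 1) = c * (2 * pi / b) / (q + 1) * norm (z - node k)"
      unfolding nw by (simp only: mult.assoc times_divide_eq_left times_divide_eq_right)
    finally show "c * (2 * pi / b) / (q + 1) * norm (z - node k) \<le> norm (row_factor z)"
      by (simp only: row_factor_def norm_divide)
  qed
qed

text \<open>The exponential decay is weakened to \<open>1 / Im z\<close>. That suffices, because the
  heights at which it is used grow geometrically with the scale.\<close>

lemma norm_nome_le:
  assumes "Im z > 0"
  shows "norm (nome z) \<le> b / (2 * pi) / Im z"
proof -
  define x where "x = 2 * pi * Im z / b"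
  have x: "x > 0" using assms b_pos by (simp add: x_def)
  have "x \<le> exp x" using exp_ge_add_one_self[of x] by linarith
  then have "exp (- x) \<le> 1 / x" using x by (simp add: exp_minus divide_simps)
  then show ?thesis using assms b_pos by (simp add: norm_nome x_def)
qed

lemma one_minus_norm_nome_le: "1 - norm (nome z) \<le> 2 * pi / b * Im z"
  using exp_ge_add_one_self[of "- (2 * pi * Im z / b)"] by (simp add: norm_nome)

lemma row_far:
  assumes "Im z > 0"
  shows "norm (of_real q * row_factor z - 1) \<le> (q + 1) * (b / (2 * pi)) / Im z"
proof -
  have "of_real q * row_factor z - 1 = of_real (1 - q\<^sup>2) * nome z / (of_real q - nome z)"
    using q_minus_nome_nonzero[OF assms] by (simp add: row_factor_def divide_simps power2_eq_square algebra_simps)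
  also have "norm \<dots> = (q\<^sup>2 - 1) * norm (nome z) / norm (of_real q - nome z)"
    unfolding norm_divide norm_mult norm_of_real using q_gt_1 by (simp add: abs_if one_le_power power_strict_mono)
  also have "\<dots> \<le> (q\<^sup>2 - 1) * norm (nome z) / (q - 1)"
    using norm_q_minus_nome(2)[OF assms] q_gt_1 norm_q_minus_nome(3)[OF assms]
    by (intro divide_left_mono) auto
  also have "\<dots> = (q + 1) * norm (nome z)"
    using q_gt_1 by (simp add: field_simps power2_eq_square)
  also have "\<dots> \<le> (q + 1) * (b / (2 * pi) / Im z)"
    using norm_nome_le[OF assms] q_gt_1 by (intro mult_left_mono) auto
  finally show ?thesis by simp
qed

text \<open>The bound involves \<open>norm z\<close> and not \<open>Im z\<close>: on the real line
  \<open>row_factor\<close> has modulus 1 but takes the value \<open>- 1\<close> only at the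
  periods. This serves locally uniform convergence, but not estimates uniform in
  \<open>Re z\<close>.\<close>

lemma row_near:
  assumes "Im z > 0"
  shows "norm (- row_factor z - 1) \<le> (q + 1) / (q - 1) * (2 * pi / b) * norm z"
proof -
  have "- row_factor z - 1 = of_real (q + 1) * (nome z - 1) / (of_real q - nome z)"
    using q_minus_nome_nonzero[OF assms] by (simp add: row_factor_def divide_simps algebra_simps)
  also have "norm \<dots> = (q + 1) * norm (1 - nome z) / norm (of_real q - nome z)"
    unfolding norm_divide norm_mult norm_of_real using q_gt_1 by (simp add: norm_minus_commute)
  also have "\<dots> \<le> (q + 1) * norm (1 - nome z) / (q - 1)"
    using norm_q_minus_nome(2)[OF assms] q_gt_1 norm_q_minus_nome(3)[OF assms]
    by (intro divide_left_mono) auto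
  also have "norm (1 - nome z) \<le> norm (2 * of_real pi * \<i> * z / of_real b)"
    unfolding nome_def using assms b_pos by (intro norm_one_minus_exp_le) simp
  also have "\<dots> = 2 * pi / b * norm z"
    using b_pos by (simp add: norm_mult norm_divide)
  finally show ?thesis
    using q_gt_1 by (simp add: divide_right_mono mult_left_mono mult_ac)
qed

text \<open>The half-plane \<open>Im z \<ge> sqrt a\<close> lies above the row of zeros: there
  \<open>q * norm (nome z)\<close> is at most \<open>q powr (1 - sqrt a)\<close>, which is less than
  1.\<close>

lemma inverse_row_far:
  obtains C where "C > 0" "\<And>z. Im z \<ge> sqrt a \<Longrightarrow> row_factor z \<noteq> 0 \<and> norm (1 / (of_real q * row_factor z)) \<le> 1 + C / Im z"
proof -
  define \<delta> where "\<delta> = 1 - q * exp (- (2 * pi * sqrt a / b))"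
  have "q * exp (- (2 * pi * sqrt a / b)) = exp (2 * pi / b * (1 - sqrt a))"
    unfolding q_def exp_add[symmetric] by (simp add: right_diff_distrib)
  then have d: "\<delta> > 0"
    using b_pos a_gt_1 by (simp add: \<delta>_def divide_less_0_iff mult_less_0_iff)
  define C where "C = q / \<delta> * (b / (2 * pi))"
  show ?thesis
  proof (rule that[of C])
    show "C > 0" using d q_gt_1 b_pos by (simp add: C_def)
    fix z assume z: "Im z \<ge> sqrt a"
    then have im: "Im z > 0" using a_gt_1 by (meson less_le_trans order.strict_trans zero_less_one real_sqrt_gt_0_iff)
    have "norm (nome z) \<le> exp (- (2 * pi * sqrt a / b))"
      using z b_pos by (simp add: norm_nome divide_right_mono)
    then have "q * norm (nome z) \<le> 1 - \<delta>"
      using q_gt_1 by (simp add: \<delta>_def)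
    then have nz: "norm (1 - of_real q * nome z) \<ge> \<delta>"
      using norm_triangle_ineq2[of 1 "of_real q * nome z"] q_gt_1 by (simp add: norm_mult)
    then have nz': "1 - of_real q * nome z \<noteq> 0" using d by auto
    have "1 / (of_real q * row_factor z) = 1 + (of_real (q - 1 / q) * nome z) / (1 - of_real q * nome z)"
      using nz' q_gt_1 q_minus_nome_nonzero[OF im]
      by (simp add: row_factor_def divide_simps) (simp add: algebra_simps)
    also have "norm \<dots> \<le> 1 + norm (of_real (q - 1 / q) * nome z) / norm (1 - of_real q * nome z)"
      using norm_triangle_ineq[of 1 "of_real (q - 1 / q) * nome z / (1 - of_real q * nome z)"]
      by (simp only: norm_divide norm_one)
    also have "\<dots> \<le> 1 + (q * (b / (2 * pi) / Im z)) / \<delta>"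
    proof (intro add_left_mono frac_le)
      have "1 / q < q" using q_gt_1 by (smt (verit) divide_less_eq_1)
      then show "norm (of_real (q - 1 / q) * nome z) \<le> q * (b / (2 * pi) / Im z)"
        unfolding norm_mult norm_of_real
        using norm_nome_le[OF im] q_gt_1 by (intro mult_mono) (auto simp: abs_if)
    qed (use nz d im b_pos q_gt_1 in auto)
    finally show "row_factor z \<noteq> 0 \<and> norm (1 / (of_real q * row_factor z)) \<le> 1 + C / Im z"
      using nz' q_minus_nome_nonzero[OF im] by (simp add: C_def row_factor_def mult_ac)
  qed
qed

text \<open>This region lies below the row of zeros, since \<open>q * norm (nome z) > 1\<close>
  there. In contrast to \<open>row_near\<close> only the modulus matters; it tends to 1 at the whole
  real line, so the error is of order \<open>Im z\<close>, uniformly in \<open>Re z\<close>.\<close>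

lemma inverse_row_near:
  obtains C where "C > 0"
    "\<And>z. 0 < Im z \<Longrightarrow> Im z \<le> 1 / sqrt a \<Longrightarrow> row_factor z \<noteq> 0 \<and> norm (1 / row_factor z) \<le> 1 + C * Im z"
proof -
  define \<delta> where "\<delta> = q * exp (- (2 * pi * (1 / sqrt a) / b)) - 1"
  have "q * exp (- (2 * pi * (1 / sqrt a) / b)) = exp (2 * pi / b * (1 - 1 / sqrt a))"
    unfolding q_def exp_add[symmetric] by (simp add: right_diff_distrib)
  then have d: "\<delta> > 0"
    using b_pos a_gt_1 by (simp add: \<delta>_def)
  define C where "C = (q + 1) * (2 * pi / b) / \<delta>"
  show ?thesis
  proof (rule that[of C])
    show "C > 0" using d q_gt_1 b_pos by (simp add: C_def)
    fix z assume im: "0 < Im z" and z: "Im z \<le> 1 / sqrt a"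
    define r where "r = norm (nome z)"
    have r0: "r \<ge> 0" and r1: "r < 1"
      using norm_nome_less_1[OF im] by (simp_all add: r_def)
    have "r \<ge> exp (- (2 * pi * (1 / sqrt a) / b))"
      unfolding r_def norm_nome exp_le_cancel_iff neg_le_iff_le
      by (intro divide_right_mono mult_left_mono) (use z b_pos in simp_all)
    then have r: "q * r - 1 \<ge> \<delta>"
      using q_gt_1 unfolding \<delta>_def by simp
    define e where "e = nome z"
    have re: "norm e = r" by (simp add: e_def r_def)
    text \<open>The Schwarz--Pick bound for the Blaschke factor with zero \<open>1 / q\<close>.\<close>
    have "((q * r - 1) * norm (of_real q - e))\<^sup>2 \<le> ((q - r) * norm (1 - of_real q * e))\<^sup>2"
    proof -
      have 1: "(norm (of_real q - e))\<^sup>2 = q\<^sup>2 - 2 * q * Re e + r\<^sup>2"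
        "(norm (1 - of_real q * e))\<^sup>2 = 1 - 2 * q * Re e + q\<^sup>2 * r\<^sup>2"
        unfolding re[symmetric] cmod_power2 by (simp_all add: power2_eq_square algebra_simps)
      have "Re e \<le> r" using complex_Re_le_cmod[of e] re by simp
      then have "0 \<le> 2 * q * (r - Re e) * ((q\<^sup>2 - 1) * (1 - r\<^sup>2))"
        using r1 q_gt_1 power_le_one[of r 2] r0 one_le_power[of q 2]
        by (intro mult_nonneg_nonneg) simp_all
      also have "\<dots> = (q - r)\<^sup>2 * (1 - 2 * q * Re e + q\<^sup>2 * r\<^sup>2)
          - (q * r - 1)\<^sup>2 * (q\<^sup>2 - 2 * q * Re e + r\<^sup>2)"
        by (simp add: power2_eq_square algebra_simps)
      finally show ?thesis
        unfolding power_mult_distrib 1 by simp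
    qed
    then have le: "(q * r - 1) * norm (of_real q - e) \<le> (q - r) * norm (1 - of_real q * e)"
      by (rule power2_le_imp_le) (use r1 q_gt_1 in simp)
    have "norm (of_real q - e) > 0"
      using norm_q_minus_nome(3)[OF im] by (simp add: e_def)
    then have "(q * r - 1) * norm (of_real q - e) > 0"
      using r d by simp
    with le have "(q - r) * norm (1 - of_real q * e) > 0" by (rule less_le_trans[rotated])
    then have nz: "norm (1 - of_real q * e) > 0"
      using r1 q_gt_1 by (simp add: zero_less_mult_iff)
    have pos: "q * r - 1 > 0" using r d by simp
    have "norm (1 / row_factor z) = norm (of_real q - e) / norm (1 - of_real q * e)"
      by (simp add: row_factor_def e_def norm_divide)
    also have "\<dots> \<le> (q - r) / (q * r - 1)"
      using mult_imp_div_pos_le[OF nz] le pos by (simp add: pos_le_divide_eq mult.commute)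
    also have "\<dots> = 1 + (q + 1) * (1 - r) / (q * r - 1)"
      using pos by (simp add: field_simps)
    also have "\<dots> \<le> 1 + (q + 1) * (2 * pi / b * Im z) / \<delta>"
    proof (intro add_left_mono frac_le mult_left_mono)
      show "1 - r \<le> 2 * pi / b * Im z"
        unfolding r_def by (rule one_minus_norm_nome_le)
    qed (use r d q_gt_1 im b_pos in simp_all)
    also have "\<dots> = 1 + C * Im z"
      by (simp only: C_def mult.assoc times_divide_eq_left)
    finally have "norm (1 / row_factor z) \<le> 1 + C * Im z" .
    moreover have "row_factor z \<noteq> 0"
      using nz \<open>norm (of_real q - e) > 0\<close> unfolding row_factor_def e_def[symmetric] by simp
    ultimately show "row_factor z \<noteq> 0 \<and> norm (1 / row_factor z) \<le> 1 + C * Im z" by blast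
  qed
qed

section \<open>The product over all scales: convergence and self-similarity\<close>

definition pair :: "nat \<Rightarrow> complex \<Rightarrow> complex" where
  "pair n z = of_real q * row_factor (of_real (a ^ Suc n) * z) * - row_factor (of_real (1 / a ^ Suc n) * z)"

definition partial_F :: "nat \<Rightarrow> complex \<Rightarrow> complex" where
  "partial_F N z = (\<Prod>n<N. pair n z)"

text \<open>\<open>pair n\<close> joins the scales \<open>a ^ Suc n\<close> and
  \<open>1 / a ^ Suc n\<close>, each normalised to tend to 1. Scale 0 stands apart: it alone has
  zeros in the central strip.\<close>

definition F :: "complex \<Rightarrow> complex" where
  "F z = row_factor z * lim (\<lambda>N. partial_F N z)"

lemma geometric_sum_le: "(\<Sum>n<N. (1 / a) ^ n) \<le> a / (a - 1)"
proof -
  have "(\<Sum>n<N. (1 / a) ^ n) \<le> (\<Sum>n. (1 / a) ^ n)"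
    using a_gt_1 by (intro sum_le_suminf summable_geometric) auto
  also have "\<dots> = 1 / (1 - 1 / a)"
    using a_gt_1 by (intro suminf_geometric) auto
  finally show ?thesis
    using a_gt_1 by (simp add: field_simps)
qed

lemma prod_geometric_le:
  assumes "\<And>n. n < N \<Longrightarrow> 0 \<le> x n" "\<And>n. n < N \<Longrightarrow> x n \<le> 1 + C * (1 / a) ^ n" "C \<ge> 0"
  shows "(\<Prod>n<N. x n) \<le> exp (C * (a / (a - 1)))"
proof -
  have "(\<Prod>n<N. x n) \<le> (\<Prod>n<N. 1 + C * (1 / a) ^ n)"
    using assms by (intro prod_mono) auto
  also have "\<dots> \<le> exp (\<Sum>n<N. C * (1 / a) ^ n)"
    using assms(3) a_gt_1 by (intro prod_le_exp_sum) auto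
  also have "(\<Sum>n<N. C * (1 / a) ^ n) \<le> C * (a / (a - 1))"
    unfolding sum_distrib_left[symmetric] by (intro mult_left_mono geometric_sum_le assms)
  finally show ?thesis by simp
qed

text \<open>The term \<open>1 / Im z\<close> comes from the expanded factor
  (\<open>row_far\<close>), the term \<open>norm z\<close> from the contracted one
  (\<open>row_near\<close>); both gain a power of \<open>1 / a\<close>.\<close>

lemma pair_minus_1_le:
  obtains K where "K \<ge> 0"
    "\<And>n z. Im z > 0 \<Longrightarrow> norm (pair n z - 1) \<le> K * (1 / Im z + norm z) * (1 / a) ^ n"
proof -
  define K where "K = max ((q + 1) * (b / (2 * pi))) ((q + 1) / (q - 1) * (2 * pi / b))"
  show ?thesis
  proof (rule that[of K])
    show K0: "K \<ge> 0"
      unfolding K_def by (rule order_trans[OF _ max.cobounded1]) (use q_gt_1 b_pos in simp)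
    fix n z assume z: "Im z > 0"
    have an: "a ^ Suc n \<ge> a ^ n" "a ^ n > 0"
      using a_gt_1 by (auto intro: power_increasing)
    define u where "u = of_real q * row_factor (of_real (a ^ Suc n) * z)"
    define v where "v = - row_factor (of_real (1 / a ^ Suc n) * z)"
    have im: "Im (of_real (a ^ Suc n) * z) = a ^ Suc n * Im z"
      "Im (of_real (1 / a ^ Suc n) * z) = Im z / a ^ Suc n"
      unfolding times_complex.sel Re_complex_of_real Im_complex_of_real by simp_all
    have u: "norm (u - 1) \<le> K / Im z * (1 / a) ^ n"
    proof -
      have "norm (u - 1) \<le> (q + 1) * (b / (2 * pi)) / (a ^ Suc n * Im z)"
        unfolding u_def using row_far[of "of_real (a ^ Suc n) * z"] z a_gt_1 im(1) by simp
      also have "\<dots> \<le> K / (a ^ n * Im z)"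
        using an z q_gt_1 b_pos by (intro frac_le) (auto simp: K_def intro: order_trans[OF _ max.cobounded1])
      finally show ?thesis by (simp add: power_divide field_simps)
    qed
    have v: "norm (v - 1) \<le> K * norm z * (1 / a) ^ n"
    proof -
      have "norm (v - 1) \<le> (q + 1) / (q - 1) * (2 * pi / b) * norm (of_real (1 / a ^ Suc n) * z)"
        unfolding v_def using z a_gt_1 im(2) by (intro row_near) (simp del: of_real_divide)
      also have "norm (of_real (1 / a ^ Suc n) * z) = norm z / a ^ Suc n"
        unfolding norm_mult norm_of_real using a_gt_1 by simp
      also have "(q + 1) / (q - 1) * (2 * pi / b) * (norm z / a ^ Suc n) \<le> K * (norm z / a ^ n)"
        using an a_gt_1 q_gt_1 b_pos K0 by (intro mult_mono frac_le) (auto simp: K_def)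
      finally show ?thesis by (simp add: power_divide field_simps)
    qed
    have v1: "norm v \<le> 1"
      unfolding v_def norm_minus_cancel using z a_gt_1 im(2) by (intro norm_row_le_1) simp
    have "pair n z - 1 = (u - 1) * v + (v - 1)"
      by (simp add: pair_def u_def v_def algebra_simps)
    also have "norm \<dots> \<le> norm (u - 1) * norm v + norm (v - 1)"
      by (metis norm_mult norm_triangle_ineq)
    also have "\<dots> \<le> norm (u - 1) * 1 + norm (v - 1)"
      using v1 by (intro add_mono mult_left_mono) auto
    also have "\<dots> \<le> K / Im z * (1 / a) ^ n + K * norm z * (1 / a) ^ n"
      using u v by simp
    finally show "norm (pair n z - 1) \<le> K * (1 / Im z + norm z) * (1 / a) ^ n"
      by (simp add: algebra_simps)
  qed
qed

lemma holomorphic_pair: "pair n holomorphic_on uhp"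
proof -
  have "Im (of_real c * z) > 0" if "c > 0" "Im z > 0" for c z
    using that by simp
  then show ?thesis
    unfolding pair_def using a_gt_1 by (intro holomorphic_intros) auto
qed

lemma partial_F_uniform_limit:
  assumes z: "Im z > 0"
  shows "\<exists>d>0. cball z d \<subseteq> uhp \<and>
     uniform_limit (cball z d) partial_F (\<lambda>w. lim (\<lambda>N. partial_F N w)) sequentially"
proof -
  obtain K where K: "K \<ge> 0"
    "\<And>n z. Im z > 0 \<Longrightarrow> norm (pair n z - 1) \<le> K * (1 / Im z + norm z) * (1 / a) ^ n"
    using pair_minus_1_le by metis
  define d where "d = Im z / 2"
  have d: "d > 0" using z by (simp add: d_def)
  have w: "Im w \<ge> d" "norm w \<le> norm z + d" if "w \<in> cball z d" for w
  proof -
    have *: "norm (z - w) \<le> d" using that by (simp add: dist_norm)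
    with abs_Im_le_cmod[of "z - w"] show "Im w \<ge> d"
      unfolding minus_complex.sel d_def by linarith
    show "norm w \<le> norm z + d"
      using * norm_triangle_ineq2[of w z] by (simp add: norm_minus_commute)
  qed
  have sub: "cball z d \<subseteq> uhp" using w(1) d by force
  have "uniformly_convergent_on (cball z d) (\<lambda>N x. \<Prod>n<N. pair n x)"
  proof (rule uniformly_convergent_on_prod')
    show "continuous_on (cball z d) (pair n)" for n
      using holomorphic_pair sub holomorphic_on_imp_continuous_on holomorphic_on_subset by metis
    show "uniformly_convergent_on (cball z d) (\<lambda>N x. \<Sum>n<N. norm (pair n x - 1))"
    proof (rule Weierstrass_m_test')
      show "summable (\<lambda>n. K * (1 / d + (norm z + d)) * (1 / a) ^ n)"
        using a_gt_1 by (intro summable_mult summable_geometric) auto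
      fix n x assume x: "x \<in> cball z d"
      then have "norm (pair n x - 1) \<le> K * (1 / Im x + norm x) * (1 / a) ^ n"
        using sub by (intro K) auto
      also have "\<dots> \<le> K * (1 / d + (norm z + d)) * (1 / a) ^ n"
        using w[OF x] d K(1) a_gt_1 by (intro mult_right_mono mult_left_mono add_mono frac_le) auto
      finally show "norm (norm (pair n x - 1)) \<le> K * (1 / d + (norm z + d)) * (1 / a) ^ n"
        by simp
    qed
  qed simp
  then show ?thesis
    using d sub unfolding uniformly_convergent_uniform_limit_iff partial_F_def by blast
qed

lemma holomorphic_F: "F holomorphic_on uhp"
proof -
  have "(\<lambda>w. lim (\<lambda>N. partial_F N w)) holomorphic_on uhp"
  proof (rule holomorphic_uniform_sequence[OF open_uhp])
    show "partial_F n holomorphic_on uhp" for n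
      unfolding partial_F_def by (intro holomorphic_intros holomorphic_pair)
  qed (use partial_F_uniform_limit in auto)
  then show ?thesis
    unfolding F_def by (intro holomorphic_intros) auto
qed

lemma partial_F_tendsto:
  assumes "Im z > 0"
  shows "(\<lambda>N. partial_F N z) \<longlonglongrightarrow> lim (\<lambda>N. partial_F N z)"
  using partial_F_uniform_limit[OF assms] tendsto_uniform_limitI by fastforce

lemma F_tendsto:
  assumes "Im z > 0"
  shows "(\<lambda>N. row_factor z * partial_F N z) \<longlonglongrightarrow> F z"
  unfolding F_def by (intro tendsto_intros partial_F_tendsto assms)

lemma tendsto_over_powers: "(\<lambda>n. c * (1 / a) ^ n) \<longlonglongrightarrow> 0"
  using a_gt_1 by (intro tendsto_mult_right_zero LIMSEQ_realpow_zero) auto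

lemma row_shrink_tendsto:
  assumes "Im z > 0"
  shows "(\<lambda>N. row_factor (of_real (1 / a ^ N) * z)) \<longlonglongrightarrow> - 1"
proof -
  have "(\<lambda>N. - row_factor (of_real (1 / a ^ N) * z) - 1) \<longlonglongrightarrow> 0"
  proof (rule Lim_null_comparison[OF always_eventually tendsto_over_powers], rule allI)
    fix N
    have "Im (of_real (1 / a ^ N) * z) > 0"
      unfolding times_complex.sel Re_complex_of_real Im_complex_of_real using a_gt_1 assms by simp
    from row_near[OF this] show "norm (- row_factor (of_real (1 / a ^ N) * z) - 1)
        \<le> ((q + 1) / (q - 1) * (2 * pi / b) * norm z) * (1 / a) ^ N"
      unfolding norm_mult norm_of_real using a_gt_1 by (simp add: power_divide)
  qed
  from tendsto_diff[OF tendsto_const[of "-1"] this] show ?thesis by simp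
qed

lemma row_grow_tendsto:
  assumes "Im z > 0"
  shows "(\<lambda>N. of_real q * row_factor (of_real (a ^ N) * z)) \<longlonglongrightarrow> 1"
proof -
  have "(\<lambda>N. of_real q * row_factor (of_real (a ^ N) * z) - 1) \<longlonglongrightarrow> 0"
  proof (rule Lim_null_comparison[OF always_eventually tendsto_over_powers], rule allI)
    fix N
    have im: "Im (of_real (a ^ N) * z) = a ^ N * Im z"
      unfolding times_complex.sel Re_complex_of_real Im_complex_of_real by simp
    with row_far[of "of_real (a ^ N) * z"]
    show "norm (of_real q * row_factor (of_real (a ^ N) * z) - 1)
       \<le> ((q + 1) * (b / (2 * pi)) / Im z) * (1 / a) ^ N"
      using assms a_gt_1 by (simp add: power_divide field_simps)
  qed
  from tendsto_add[OF this tendsto_const[of 1]] show ?thesis by simp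
qed

text \<open>Replacing \<open>z\<close> by \<open>a * z\<close> shifts the scales
  \<open>-N..N\<close> by one. After adding the missing end factor, each side is the product over
  the scales \<open>-N..N+1\<close>, with the same constants. Multiplying by the end factors instead
  of dividing avoids case distinctions at their zeros.\<close>

lemma partial_F_scale:
  "row_factor (of_real a * z) * partial_F N (of_real a * z) * row_factor (of_real (1 / a ^ N) * z) =
     row_factor z * partial_F N z * row_factor (of_real (a ^ Suc N) * z)"
proof (induction N)
  case 0
  then show ?case by (simp add: partial_F_def)
next
  case (Suc N)
  have 1: "of_real (a ^ Suc N) * (of_real a * z) = of_real (a ^ Suc (Suc N)) * z"
    "of_real (1 / a ^ Suc N) * (of_real a * z) = of_real (1 / a ^ N) * z"
    using a_gt_1 by (simp_all add: field_simps)
  have assoc: "A * (P * (c * D * - B)) * G = (A * P * B) * (c * D * - G)"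
    and assoc': "(A * P * B) * (c * D * - G) = A * (P * (c * B * - G)) * D" for A P B c D G :: complex
    by (simp_all only: mult_minus_left mult_minus_right mult_ac)
  have "row_factor (of_real a * z) * partial_F (Suc N) (of_real a * z) * row_factor (of_real (1 / a ^ Suc N) * z) =
    (row_factor (of_real a * z) * partial_F N (of_real a * z) * row_factor (of_real (1 / a ^ N) * z)) *
      (of_real q * row_factor (of_real (a ^ Suc (Suc N)) * z) * - row_factor (of_real (1 / a ^ Suc N) * z))"
    unfolding partial_F_def prod.lessThan_Suc pair_def[of N] 1 by (rule assoc)
  also have "\<dots> = row_factor z * partial_F (Suc N) z * row_factor (of_real (a ^ Suc (Suc N)) * z)"
    unfolding Suc.IH unfolding partial_F_def prod.lessThan_Suc pair_def[of N] by (rule assoc')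
  finally show ?case .
qed

text \<open>The two end factors of \<open>partial_F_scale\<close> tend to \<open>- 1\<close> and
  \<open>1 / q\<close>; their quotient is the multiplier.\<close>

lemma F_scale:
  assumes z: "Im z > 0"
  shows "F (of_real a * z) = - (1 / of_real q) * F z"
proof -
  have az: "Im (of_real a * z) > 0" using z a_gt_1 by simp
  have q: "complex_of_real q \<noteq> 0" using q_gt_1 by simp
  have "(\<lambda>N. row_factor (of_real a * z) * partial_F N (of_real a * z) * row_factor (of_real (1 / a ^ N) * z))
     \<longlonglongrightarrow> F (of_real a * z) * - 1"
    by (intro tendsto_mult[OF F_tendsto[OF az] row_shrink_tendsto[OF z]])
  moreover have "(\<lambda>N. row_factor z * partial_F N z * (of_real q * row_factor (of_real (a ^ Suc N) * z)) / of_real q)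
     \<longlonglongrightarrow> F z * 1 / of_real q"
    using q by (intro tendsto_divide tendsto_mult[OF F_tendsto[OF z] LIMSEQ_Suc[OF row_grow_tendsto[OF z]]] tendsto_const)
  moreover have "row_factor (of_real a * z) * partial_F N (of_real a * z) * row_factor (of_real (1 / a ^ N) * z) =
     row_factor z * partial_F N z * (of_real q * row_factor (of_real (a ^ Suc N) * z)) / of_real q" for N
    using partial_F_scale[of z N] q by simp
  ultimately have "F (of_real a * z) * - 1 = F z * 1 / of_real q"
    using LIMSEQ_unique by fastforce
  then show ?thesis by (simp add: eq_neg_iff_add_eq_0 neg_eq_iff_add_eq_0 add.commute)
qed

lemma F_node: "F (node k) = 0"
  by (simp add: F_def row_node)

text \<open>For \<open>z\<close> in the strip the expanded arguments lie above \<open>sqrt a\<close>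
  and the contracted ones below \<open>1 / sqrt a\<close>, the ranges of
  \<open>inverse_row_far\<close> and \<open>inverse_row_near\<close>, with a geometric
  margin.\<close>

lemma Im_pair_args:
  assumes "z \<in> central_strip a"
  shows "Im (of_real (a ^ Suc n) * z) \<ge> sqrt a * a ^ n"
    "Im (of_real (1 / a ^ Suc n) * z) \<le> (1 / sqrt a) * (1 / a) ^ n"
    "0 < Im (of_real (a ^ Suc n) * z)" "0 < Im (of_real (1 / a ^ Suc n) * z)"
proof -
  have z: "Im z > 0" using assms central_strip_subset_uhp[OF a_gt_1] by auto
  have s: "1 / sqrt a = sqrt a / a" "sqrt a * sqrt a = a" "sqrt a > 0"
    using a_gt_1 by (simp_all add: real_div_sqrt field_simps)
  have "a * (1 / sqrt a) \<le> a * Im z"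
    by (rule mult_left_mono) (use assms a_gt_1 in \<open>auto simp: central_strip_def\<close>)
  moreover have "Im z / a \<le> sqrt a / a"
    by (rule divide_right_mono) (use assms a_gt_1 in \<open>auto simp: central_strip_def\<close>)
  ultimately have le: "sqrt a \<le> a * Im z" "Im z / a \<le> 1 / sqrt a"
    using a_gt_1 s by (simp_all add: real_div_sqrt)
  have im: "Im (of_real (a ^ Suc n) * z) = (a * Im z) * a ^ n"
    "Im (of_real (1 / a ^ Suc n) * z) = (Im z / a) * (1 / a) ^ n"
    unfolding times_complex.sel Re_complex_of_real Im_complex_of_real
    by (simp_all add: power_divide)
  show "Im (of_real (a ^ Suc n) * z) \<ge> sqrt a * a ^ n"
    unfolding im using a_gt_1 by (intro mult_right_mono le) auto
  show "Im (of_real (1 / a ^ Suc n) * z) \<le> (1 / sqrt a) * (1 / a) ^ n"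
    unfolding im using a_gt_1 by (intro mult_right_mono le) auto
  show "0 < Im (of_real (a ^ Suc n) * z)" "0 < Im (of_real (1 / a ^ Suc n) * z)"
    unfolding im using z a_gt_1 by auto
qed

text \<open>Contracted factors have norm at most 1, and expanded ones exceed 1 by a geometrically
  small amount, so the partial products are bounded uniformly in \<open>N\<close> and in
  \<open>Re z\<close>.\<close>

lemma F_bounded_central_strip:
  obtains C where "\<And>z. z \<in> central_strip a \<Longrightarrow> norm (F z) \<le> C"
proof -
  define c where "c = (q + 1) * (b / (2 * pi)) / sqrt a"
  have c: "c \<ge> 0" using q_gt_1 b_pos a_gt_1 by (simp add: c_def)
  show ?thesis
  proof (rule that)
    fix z assume z: "z \<in> central_strip a"
    note im = Im_pair_args[OF z]
    have imz: "Im z > 0" using z central_strip_subset_uhp[OF a_gt_1] by auto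
    have pair: "norm (pair n z) \<le> 1 + c * (1 / a) ^ n" for n
    proof -
      have "norm (of_real q * row_factor (of_real (a ^ Suc n) * z))
          \<le> norm (of_real q * row_factor (of_real (a ^ Suc n) * z) - 1) + 1"
        using norm_triangle_ineq[of "of_real q * row_factor (of_real (a ^ Suc n) * z) - 1" 1] by simp
      also have "\<dots> \<le> (q + 1) * (b / (2 * pi)) / Im (of_real (a ^ Suc n) * z) + 1"
        by (intro add_right_mono row_far im)
      also have "\<dots> \<le> (q + 1) * (b / (2 * pi)) / (sqrt a * a ^ n) + 1"
        using im[of n] q_gt_1 b_pos a_gt_1 by (intro add_right_mono divide_left_mono) auto
      also have "\<dots> = 1 + c * (1 / a) ^ n"
        by (simp add: c_def power_divide)
      finally have "norm (pair n z) \<le> (1 + c * (1 / a) ^ n) * 1"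
        unfolding pair_def norm_mult[of "_ * _"] norm_minus_cancel
        using c a_gt_1 by (intro mult_mono norm_row_le_1 im) auto
      then show ?thesis by simp
    qed
    have "norm (row_factor z * partial_F N z) \<le> exp (c * (a / (a - 1)))" for N
    proof -
      have "norm (row_factor z * partial_F N z) \<le> 1 * norm (partial_F N z)"
        unfolding norm_mult by (intro mult_right_mono norm_row_le_1 imz) auto
      also have "norm (partial_F N z) \<le> exp (c * (a / (a - 1)))"
        unfolding partial_F_def prod_norm[symmetric] using pair c
        by (intro prod_geometric_le) auto
      finally show ?thesis by simp
    qed
    then show "norm (F z) \<le> exp (c * (a / (a - 1)))"
      using F_tendsto[OF imz] by (intro Lim_bounded[OF tendsto_norm]) auto
  qed
qed

text \<open>Only the factor at scale 0 can be small in the strip. The inverses of all the other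
  factors have a product bounded independently of \<open>N\<close>, so the bound of
  \<open>row_lower_bound\<close> survives in the limit up to a constant.\<close>

lemma F_lower_bound:
  obtains c where "c > 0" "\<And>z k. z \<in> central_strip a \<Longrightarrow> \<bar>Re z - b * of_int k\<bar> \<le> b / 2 \<Longrightarrow>
     c * norm (z - node k) \<le> norm (F z)"
proof -
  obtain c where c: "c > 0" "\<And>z k. z \<in> central_strip a \<Longrightarrow> \<bar>Re z - b * of_int k\<bar> \<le> b / 2 \<Longrightarrow>
     c * norm (z - node k) \<le> norm (row_factor z)"
    using row_lower_bound by metis
  obtain C where C: "C > 0" "\<And>z. Im z \<ge> sqrt a \<Longrightarrow> row_factor z \<noteq> 0 \<and> norm (1 / (of_real q * row_factor z)) \<le> 1 + C / Im z"
    using inverse_row_far by metis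
  obtain D where D: "D > 0"
    "\<And>z. 0 < Im z \<Longrightarrow> Im z \<le> 1 / sqrt a \<Longrightarrow> row_factor z \<noteq> 0 \<and> norm (1 / row_factor z) \<le> 1 + D * Im z"
    using inverse_row_near by metis
  \<comment> \<open>The coefficients of \<open>(1 + C / sqrt a * t) * (1 + D / sqrt a * t)\<close>,
    with \<open>t * t \<le> t\<close> used for the cross term.\<close>
  define K where "K = C / sqrt a + D / sqrt a + (C / sqrt a) * (D / sqrt a)"
  define M where "M = exp (K * (a / (a - 1)))"
  have K: "K \<ge> 0" using C D a_gt_1 by (simp add: K_def)
  have partial: "1 / M \<le> norm (partial_F N z)" if z: "z \<in> central_strip a" for z N
  proof -
    note im = Im_pair_args[OF z]
    have pair: "pair n z \<noteq> 0" "norm (1 / pair n z) \<le> 1 + K * (1 / a) ^ n" for n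
    proof -
      define t where "t = (1 / a) ^ n"
      have t: "0 \<le> t" "t \<le> 1" using a_gt_1 by (auto simp: t_def intro!: power_le_one)
      have an: "a ^ n \<ge> 1" using a_gt_1 by (simp add: one_le_power)
      have 1: "sqrt a \<le> Im (of_real (a ^ Suc n) * z)"
        using order_trans[OF mult_left_mono[OF an, of "sqrt a"] im(1)[of n]] a_gt_1 by simp
      have 2: "Im (of_real (1 / a ^ Suc n) * z) \<le> 1 / sqrt a"
        using order_trans[OF im(2)[of n] mult_left_mono[of "(1 / a) ^ n" 1 "1 / sqrt a"]] t a_gt_1
        by (simp add: t_def)
      show "pair n z \<noteq> 0"
        using C(2)[OF 1] D(2)[OF im(4) 2] q_gt_1 by (simp add: pair_def)
      have "norm (1 / (of_real q * row_factor (of_real (a ^ Suc n) * z))) \<le> 1 + C / Im (of_real (a ^ Suc n) * z)"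
        using C(2)[OF 1] by blast
      also have "\<dots> \<le> 1 + C / (sqrt a * a ^ n)"
        using im[of n] C(1) a_gt_1 by (intro add_left_mono divide_left_mono) auto
      also have "\<dots> = 1 + C / sqrt a * t"
        by (simp add: t_def power_divide)
      finally have 3: "norm (1 / (of_real q * row_factor (of_real (a ^ Suc n) * z))) \<le> 1 + C / sqrt a * t" .
      have "norm (1 / row_factor (of_real (1 / a ^ Suc n) * z)) \<le> 1 + D * Im (of_real (1 / a ^ Suc n) * z)"
        using D(2)[OF im(4) 2] by blast
      also have "\<dots> \<le> 1 + D * ((1 / sqrt a) * t)"
        unfolding t_def using im(2)[of n] D(1) by (intro add_left_mono mult_left_mono) auto
      finally have 4: "norm (1 / row_factor (of_real (1 / a ^ Suc n) * z)) \<le> 1 + D / sqrt a * t" by simp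
      have "norm (1 / pair n z) = norm (1 / (of_real q * row_factor (of_real (a ^ Suc n) * z)))
          * norm (1 / row_factor (of_real (1 / a ^ Suc n) * z))"
        by (simp add: pair_def norm_mult norm_divide)
      also have "\<dots> \<le> (1 + C / sqrt a * t) * (1 + D / sqrt a * t)"
        using C(1) D(1) t a_gt_1 by (intro mult_mono 3 4) auto
      also have "\<dots> = 1 + (C / sqrt a + D / sqrt a) * t + (C / sqrt a) * (D / sqrt a) * (t * t)"
        by (simp add: algebra_simps)
      also have "\<dots> \<le> 1 + (C / sqrt a + D / sqrt a) * t + (C / sqrt a) * (D / sqrt a) * (t * 1)"
        using t C D a_gt_1 by (intro add_left_mono mult_left_mono) auto
      finally show "norm (1 / pair n z) \<le> 1 + K * (1 / a) ^ n"
        by (simp add: K_def t_def algebra_simps)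
    qed
    have "(\<Prod>n<N. norm (1 / pair n z)) \<le> M"
      unfolding M_def using pair(2) K by (intro prod_geometric_le) auto
    also have "(\<Prod>n<N. norm (1 / pair n z)) = 1 / norm (partial_F N z)"
      by (simp add: partial_F_def prod_norm norm_divide prod_dividef)
    finally have "1 / norm (partial_F N z) \<le> M" .
    moreover have "norm (partial_F N z) > 0"
      using pair(1) by (simp add: partial_F_def)
    ultimately show ?thesis
      by (simp add: M_def divide_simps mult_ac)
  qed
  show ?thesis
  proof (rule that[of "c / M"])
    show "c / M > 0" using c(1) by (simp add: M_def)
    fix z k assume z: "z \<in> central_strip a" and k: "\<bar>Re z - b * of_int k\<bar> \<le> b / 2"
    have imz: "Im z > 0" using z central_strip_subset_uhp[OF a_gt_1] by auto
    have "c * norm (z - node k) * (1 / M) \<le> norm (row_factor z * partial_F N z)" for N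
      unfolding norm_mult using c(2)[OF z k] partial[OF z] c(1)
      by (intro mult_mono) (auto simp: M_def)
    then show "c / M * norm (z - node k) \<le> norm (F z)"
      by (intro Lim_bounded2[OF tendsto_norm[OF F_tendsto[OF imz]]]) auto
  qed
qed

section \<open>Growth exponent and simple zeros of the product\<close>

definition \<beta> :: real where
  "\<beta> = ln q / ln a"

lemma q_less_a: "q < a"
  using density by (simp add: q_def)

lemma beta_pos: "\<beta> > 0"
  using q_gt_1 a_gt_1 by (simp add: \<beta>_def)

lemma a_powr_beta: "a powr \<beta> = q"
  using q_gt_1 a_gt_1 by (simp add: \<beta>_def powr_def)

lemma Im_node [simp]: "Im (node k) = 1"
  by (simp add: node_def)

lemma Re_node [simp]: "Re (node k) = b * of_int k"
  by (simp add: node_def)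

lemma node_in_strip: "node k \<in> central_strip a"
  using a_gt_1 by (simp add: central_strip_def)

lemma growth_F: "growth \<beta> F"
proof -
  obtain C where "\<And>z. z \<in> central_strip a \<Longrightarrow> norm (F z) \<le> C"
    using F_bounded_central_strip by metis
  moreover have "norm (F (of_real a * z)) = a powr (- \<beta>) * norm (F z)" if "Im z > 0" for z
    using q_gt_1 by (simp add: F_scale[OF that] norm_mult norm_divide powr_minus a_powr_beta inverse_eq_divide)
  ultimately show ?thesis
    by (intro growth_scaling[OF a_gt_1])
qed

lemma nearest_node: obtains k :: int where "\<bar>x - b * of_int k\<bar> \<le> b / 2"
proof (rule that)
  have "\<bar>x - b * of_int (round (x / b))\<bar> = b * \<bar>of_int (round (x / b)) - x / b\<bar>"
    using b_pos by (simp add: abs_mult_pos' right_diff_distrib abs_minus_commute)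
  also have "\<dots> \<le> b * (1 / 2)"
    using b_pos by (intro mult_left_mono of_int_round_abs_le) auto
  finally show "\<bar>x - b * of_int (round (x / b))\<bar> \<le> b / 2" by simp
qed

lemma F_zero_in_strip:
  assumes "z \<in> central_strip a" "F z = 0"
  obtains k where "z = node k"
proof -
  obtain c where c: "c > 0" "\<And>z k. z \<in> central_strip a \<Longrightarrow> \<bar>Re z - b * of_int k\<bar> \<le> b / 2 \<Longrightarrow>
     c * norm (z - node k) \<le> norm (F z)"
    using F_lower_bound by metis
  obtain k :: int where k: "\<bar>Re z - b * of_int k\<bar> \<le> b / 2"
    using nearest_node by metis
  from c(2)[OF assms(1) k] assms(2) have "c * norm (z - node k) \<le> 0" by simp
  then have "z = node k" using c(1) by (simp add: mult_le_0_iff)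
  then show ?thesis by (rule that)
qed

lemma F_scale_powi:
  assumes "Im z > 0"
  shows "F (of_real a powi m * z) = (- (1 / of_real q)) powi m * F z"
  using a_gt_1 q_gt_1 assms by (intro scaling_powi[of a _ F] F_scale) auto

lemma F_eq_0_iff:
  assumes "Im z > 0"
  shows "F z = 0 \<longleftrightarrow> (\<exists>j k. z = of_real a powi j * node k)"
proof
  assume z: "F z = 0"
  obtain m w where w: "w \<in> central_strip a" "z = of_real a powi m * w"
    using scale_to_central_strip[OF a_gt_1 assms] by metis
  have "Im w > 0" using w central_strip_subset_uhp[OF a_gt_1] by auto
  with z w have "F w = 0" using q_gt_1 by (simp add: F_scale_powi)
  with w show "\<exists>j k. z = of_real a powi j * node k" using F_zero_in_strip by metis
next
  assume "\<exists>j k. z = of_real a powi j * node k"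
  then show "F z = 0" by (auto simp: F_scale_powi F_node)
qed

lemma deriv_F_node_lower_bound:
  obtains c where "c > 0" "\<And>k. c \<le> norm (deriv F (node k))"
proof -
  obtain c where c: "c > 0" "\<And>z k. z \<in> central_strip a \<Longrightarrow> \<bar>Re z - b * of_int k\<bar> \<le> b / 2 \<Longrightarrow>
     c * norm (z - node k) \<le> norm (F z)"
    using F_lower_bound by metis
  show ?thesis
  proof (rule that[OF c(1)])
    fix k
    \<comment> \<open>Real offsets keep the height 1, hence stay in the strip, and offsets of at
      most \<open>b / 2\<close> keep \<open>node k\<close> admissible in
      \<open>F_lower_bound\<close>, which then bounds the difference quotients from below.\<close>
    define x where "x = (\<lambda>n. of_real (b / 2 / real (Suc n)) :: complex)"
    have "x \<longlonglongrightarrow> of_real 0"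
      unfolding x_def by (intro tendsto_of_real tendsto_divide_0[OF tendsto_const] filterlim_at_top_imp_at_infinity
          filterlim_compose[OF filterlim_real_sequentially filterlim_Suc])
    moreover have "x n \<noteq> 0" for n
      using b_pos unfolding x_def of_real_eq_0_iff by (simp del: of_nat_Suc)
    ultimately have "filterlim x (at 0) sequentially"
      unfolding filterlim_at by simp
    moreover have "((\<lambda>h. (F (node k + h) - F (node k)) / h) \<longlongrightarrow> deriv F (node k)) (at 0)"
      unfolding DERIV_def[symmetric] by (rule holomorphic_derivI[OF holomorphic_F open_uhp]) simp
    ultimately have "(\<lambda>n. (F (node k + x n) - F (node k)) / x n) \<longlonglongrightarrow> deriv F (node k)"
      by (rule filterlim_compose[rotated])
    moreover have "c \<le> norm ((F (node k + x n) - F (node k)) / x n)" for n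
    proof -
      have "b / 2 / real (Suc n) \<le> b / 2 / 1"
        using b_pos by (intro divide_left_mono) auto
      then have "c * norm (node k + x n - node k) \<le> norm (F (node k + x n))"
        using node_in_strip[of k] b_pos
        by (intro c(2)) (auto simp: x_def central_strip_def simp del: of_nat_Suc of_real_divide)
      moreover have "norm (x n) > 0" using b_pos by (simp add: x_def del: of_nat_Suc)
      ultimately show ?thesis by (simp add: F_node norm_divide pos_le_divide_eq)
    qed
    ultimately show "c \<le> norm (deriv F (node k))"
      by (intro Lim_bounded2[OF tendsto_norm]) auto
  qed
qed

lemma deriv_F_node_nonzero: "deriv F (node k) \<noteq> 0"
  using deriv_F_node_lower_bound by (metis norm_zero not_le)

lemma deriv_F_nonzero:
  assumes "Im z > 0" "F z = 0"
  shows "deriv F z \<noteq> 0"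
proof -
  obtain j k where z: "z = of_real a powi j * node k"
    using assms F_eq_0_iff by blast
  have "deriv F z = (- (1 / of_real q) / of_real a) powi j * deriv F (node k)"
    unfolding z
  proof (rule scaling_powi)
    fix w assume "Im w > 0"
    then show "deriv F (of_real a * w) = - (1 / of_real q) / of_real a * deriv F w"
      using a_gt_1 by (intro deriv_scale[OF holomorphic_F _ F_scale]) simp_all
  qed (use a_gt_1 q_gt_1 in simp_all)
  then show ?thesis
    using deriv_F_node_nonzero a_gt_1 q_gt_1 by (simp add: power_int_0_left_if)
qed

subsection \<open>Interpolation at the zeros\<close>

definition target :: "int \<Rightarrow> complex" where
  "target k = - deriv (deriv F) (node k) / (2 * deriv F (node k))"

text \<open>Vanishes at all zeros of \<open>F\<close> except \<open>node k\<close>, on every row.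
  The value \<open>F (node k)\<close> is 0; it is kept so that the form fits
  \<open>pole_lemma_open\<close>.\<close>

definition slope :: "int \<Rightarrow> complex \<Rightarrow> complex" where
  "slope k z = (if z = node k then deriv F (node k) else (F z - F (node k)) / (z - node k))"

text \<open>A Lagrange term with a convergence factor that is 1 at the node, as
  \<open>node k - cnj (node k) = 2 * \<i>\<close>. Together with \<open>slope\<close> it decays like
  the third power of the inverse distance to \<open>cnj (node k)\<close>: two powers make the sum
  over \<open>k\<close> converge, the third supplies \<open>1 / (1 + Im z)\<close>.\<close>

definition summand :: "int \<Rightarrow> complex \<Rightarrow> complex" where
  "summand k z = target k / deriv F (node k) * slope k z * ((2 * \<i>) / (z - cnj (node k)))\<^sup>2"

definition row_interp :: "complex \<Rightarrow> complex" where
  "row_interp z = (\<Sum>\<^sub>\<infinity>k. summand k z)"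

definition weight :: "int \<Rightarrow> real" where
  "weight k = 1 / (1 + (b * of_int k)\<^sup>2)"

lemma weight_pos: "weight k > 0"
  by (simp add: weight_def add_pos_nonneg)

lemma weight_summable: "weight summable_on UNIV"
proof (rule summable_on_int)
  have "summable (\<lambda>n. weight (int n))"
  proof (rule summable_comparison_test')
    show "summable (\<lambda>n. 1 / b\<^sup>2 * inverse (real n ^ 2))"
      by (intro summable_mult inverse_power_summable) simp
    fix n :: nat assume "n \<ge> 1"
    then have "1 / (1 + (b * real n)\<^sup>2) \<le> 1 / (b * real n)\<^sup>2"
      using b_pos by (intro divide_left_mono mult_pos_pos add_pos_nonneg) auto
    then show "norm (weight (int n)) \<le> 1 / b\<^sup>2 * inverse (real n ^ 2)"
      by (simp add: weight_def power_mult_distrib divide_inverse)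
  qed
  then show "summable (\<lambda>n. weight (int n))" "summable (\<lambda>n. weight (- int n))"
    by (simp_all add: weight_def)
qed (simp add: weight_pos less_imp_le)

lemma norm_minus_cnj_node: "Im z > 0 \<Longrightarrow> Im z + 1 \<le> norm (z - cnj (node k))"
  using abs_Im_le_cmod[of "z - cnj (node k)"] by simp

lemma minus_cnj_node_nonzero: "Im z > 0 \<Longrightarrow> z - cnj (node k) \<noteq> 0"
  using norm_minus_cnj_node[of z k] by auto

text \<open>The shift by \<open>m\<close> allows both a locally uniform bound (\<open>m = 0\<close>) and a bound with a global
  constant (\<open>b m\<close> close to \<open>Re z\<close>).\<close>

lemma kernel_bound:
  assumes z: "Im z > 0"
  shows "1 / norm (z - cnj (node k)) ^ 3 \<le>
    2 * (1 + (Re z - b * of_int m)\<^sup>2) / (1 + Im z) * weight (k - m)"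
proof -
  define x where "x = Re z - b * of_int m"
  define y where "y = b * of_int (k - m)"
  define N where "N = norm (z - cnj (node k))"
  have re: "Re (z - cnj (node k)) = x - y"
    by (simp add: x_def y_def algebra_simps)
  have N: "N \<ge> 1 + Im z" using norm_minus_cnj_node[OF z] by (simp add: N_def add.commute)
  have N2: "N\<^sup>2 = (x - y)\<^sup>2 + (1 + Im z)\<^sup>2"
    unfolding N_def cmod_power2 re by (simp add: add.commute)
  have "(1 + Im z)\<^sup>2 \<ge> 1" using z by (simp add: one_le_power)
  then have N2': "N\<^sup>2 \<ge> 1 + (x - y)\<^sup>2" using N2 by simp
  \<comment> \<open>Peetre's inequality: it trades the weight centred at \<open>x\<close> for one
    centred at 0, at the cost of a factor depending on \<open>x\<close> only.\<close>
  have "1 + y\<^sup>2 \<le> 2 * (1 + x\<^sup>2) * (1 + (x - y)\<^sup>2)"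
  proof -
    have "2 * (1 + x\<^sup>2) * (1 + (x - y)\<^sup>2) - (1 + y\<^sup>2)
        = 1 + (2 * x - y)\<^sup>2 + 2 * x\<^sup>2 * (x - y)\<^sup>2"
      by (simp add: power2_eq_square algebra_simps)
    then show ?thesis by (smt (verit) zero_le_power2 mult_nonneg_nonneg)
  qed
  also have "\<dots> \<le> 2 * (1 + x\<^sup>2) * N\<^sup>2"
    using N2' by (intro mult_left_mono) auto
  finally have "(1 + y\<^sup>2) * (1 + Im z) \<le> (2 * (1 + x\<^sup>2) * N\<^sup>2) * N"
    using N z by (intro mult_mono) auto
  then have "(1 + y\<^sup>2) * (1 + Im z) \<le> 2 * (1 + x\<^sup>2) * N ^ 3"
    by (simp add: power3_eq_cube power2_eq_square mult_ac)
  moreover have "N > 0" "1 + y\<^sup>2 > 0" using N z by (auto simp: add_pos_nonneg)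
  ultimately have "1 / N ^ 3 \<le> 2 * (1 + x\<^sup>2) / (1 + Im z) * (1 / (1 + y\<^sup>2))"
    using z by (simp add: divide_simps mult_ac)
  then show ?thesis by (simp add: N_def x_def y_def weight_def)
qed

lemma holomorphic_slope: "slope k holomorphic_on uhp"
  unfolding slope_def by (rule pole_lemma_open[OF holomorphic_F open_uhp])

lemma holomorphic_summand: "summand k holomorphic_on uhp"
  unfolding summand_def
  by (intro holomorphic_intros holomorphic_slope) (use minus_cnj_node_nonzero in auto)

text \<open>Replaces the distance to the node by the distance to its conjugate, which has no zero in
  the half-plane. At distance at least 1/2 from the node the two are comparable and the growth of
  \<open>F\<close> suffices; closer to it, a bound for \<open>deriv F\<close> takes over.\<close>

lemma slope_bound:
  obtains C where "C > 0" "\<And>z k. Im z > 0 \<Longrightarrow>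
    norm (slope k z) \<le> C * Im z powr (- \<beta>) / norm (z - cnj (node k))"
proof -
  obtain C where C: "C > 0" "\<And>z. Im z > 0 \<Longrightarrow> norm (F z) \<le> C * Im z powr (- \<beta>)"
    using growthE[OF growth_F] by metis
  obtain D where D: "D > 0" "\<And>z. Im z > 0 \<Longrightarrow> norm (deriv F z) \<le> D * Im z powr (- (\<beta> + 1))"
    using growthE[OF growth_deriv[OF growth_F holomorphic_F less_imp_le[OF beta_pos]]] by metis
  define M where "M = D * (1/2) powr (- (\<beta> + 1))"
  \<comment> \<open>Near a node \<open>Im z \<le> 3/2\<close> and \<open>N \<le> 5/2\<close>; the
    last two factors insert \<open>Im z powr (- \<beta>)\<close> and \<open>1 / N\<close> into the
    constant bound \<open>M\<close>.\<close>
  define E where "E = M * (3/2) powr \<beta> * (5/2)"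
  have M: "M > 0" using D by (simp add: M_def)
  have E: "E > 0" using M by (simp add: E_def)
  show ?thesis
  proof (rule that[of "max (5 * C) E"])
    fix z k assume z: "Im z > 0"
    define n where "n = norm (z - node k)"
    define N where "N = norm (z - cnj (node k))"
    have N: "N > 0" using minus_cnj_node_nonzero[OF z] by (simp add: N_def)
    have "norm (node k - cnj (node k)) = 2"
      by (simp add: cmod_def)
    then have Nn: "N \<le> n + 2"
      unfolding N_def n_def using norm_triangle_ineq[of "z - node k" "node k - cnj (node k)"] by simp
    have y: "Im z powr (- \<beta>) > 0" using z by simp
    have "norm (slope k z) \<le> max (5 * C) E * Im z powr (- \<beta>) / N"
    proof (cases "n \<ge> 1/2")
      case True
      then have "z \<noteq> node k" by (auto simp: n_def)
      then have "norm (slope k z) = norm (F z) / n"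
        by (simp add: slope_def F_node norm_divide n_def)
      also have "\<dots> \<le> (C * Im z powr (- \<beta>)) / (N / 5)"
        by (rule frac_le[OF _ C(2)[OF z]]) (use C(1) True Nn N y in simp_all)
      also have "\<dots> = (5 * C) * Im z powr (- \<beta>) / N" by simp
      also have "\<dots> \<le> max (5 * C) E * Im z powr (- \<beta>) / N"
        using N y by (intro divide_right_mono mult_right_mono) auto
      finally show ?thesis .
    next
      case False
      have imb: "Im w \<ge> 1/2" if "w \<in> ball (node k) (1/2)" for w
        using that abs_Im_le_cmod[of "node k - w"]
        unfolding minus_complex.sel Im_node mem_ball dist_norm by linarith
      have zb: "z \<in> ball (node k) (1/2)"
        using False by (simp add: n_def dist_norm norm_minus_commute)
      have db: "norm (deriv F w) \<le> M" if "w \<in> ball (node k) (1/2)" for w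
      proof -
        have "norm (deriv F w) \<le> D * Im w powr (- (\<beta> + 1))"
          using imb[OF that] by (intro D) simp
        also have "\<dots> \<le> M"
          unfolding M_def using imb[OF that] D(1) beta_pos by (intro mult_left_mono powr_mono2') simp_all
        finally show ?thesis .
      qed
      have "norm (slope k z) \<le> M"
      proof (cases "z = node k")
        case True
        then show ?thesis using db by (simp add: slope_def)
      next
        case z: False
        have "norm (F z - F (node k)) \<le> M * norm (z - node k)"
        proof (rule field_differentiable_bound[OF convex_ball[of "node k" "1/2"] _ db zb])
          fix w assume "w \<in> ball (node k) (1/2)"
          from imb[OF this] have "w \<in> uhp" by simp
          from holomorphic_derivI[OF holomorphic_F open_uhp this]
          show "(F has_field_derivative deriv F w) (at w within ball (node k) (1/2))"
            by (rule has_field_derivative_at_within)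
        qed simp_all
        then show ?thesis using z by (simp add: slope_def norm_divide divide_le_eq)
      qed
      moreover have "Im z \<le> 3/2"
        using zb abs_Im_le_cmod[of "node k - z"]
        unfolding minus_complex.sel Im_node mem_ball dist_norm by linarith
      then have "(3/2) powr (- \<beta>) \<le> Im z powr (- \<beta>)"
        using z beta_pos by (intro powr_mono2') simp_all
      then have "(3/2) powr \<beta> * (3/2) powr (- \<beta>) \<le> (3/2) powr \<beta> * Im z powr (- \<beta>)"
        by (intro mult_left_mono powr_ge_zero)
      then have "1 \<le> (3/2) powr \<beta> * Im z powr (- \<beta>)"
        by (simp flip: powr_add)
      moreover have "1 \<le> (5/2) / N"
        using False Nn N by (simp add: pos_le_divide_eq)
      ultimately have "norm (slope k z) * (1 * 1) \<le> M * (((3/2) powr \<beta> * Im z powr (- \<beta>)) * ((5/2) / N))"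
        by (rule mult_mono[OF _ mult_mono]) (use M N in simp_all)
      also have "\<dots> = E * Im z powr (- \<beta>) / N" by (simp add: E_def)
      also have "\<dots> \<le> max (5 * C) E * Im z powr (- \<beta>) / N"
        using N y by (intro divide_right_mono mult_right_mono) auto
      finally show ?thesis by simp
    qed
    then show "norm (slope k z) \<le> max (5 * C) E * Im z powr (- \<beta>) / norm (z - cnj (node k))"
      by (simp add: N_def)
  qed (use E in auto)
qed

lemma target_bounded:
  obtains D where "D > 0" "\<And>k. norm (target k / deriv F (node k)) \<le> D"
proof -
  obtain c where c: "c > 0" "\<And>k. c \<le> norm (deriv F (node k))"
    using deriv_F_node_lower_bound by metis
  have h': "deriv F holomorphic_on uhp" by (intro holomorphic_deriv holomorphic_F open_uhp)
  have "growth (\<beta> + 1 + 1) (deriv (deriv F))"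
    using beta_pos by (intro growth_deriv growth_F holomorphic_F h') auto
  then obtain C where C: "C > 0" "\<And>z. z \<in> central_strip a \<Longrightarrow> norm (deriv (deriv F) z) \<le> C"
    using growth_bounded_central_strip[OF a_gt_1] by metis
  show ?thesis
  proof (rule that[of "C / (2 * c) / c"])
    fix k
    show "norm (target k / deriv F (node k)) \<le> C / (2 * c) / c"
      unfolding target_def norm_divide norm_minus_cancel norm_mult
      using c C node_in_strip by (intro frac_le) auto
  qed (use c C in auto)
qed

lemma summand_bound:
  obtains C where "C > 0" "\<And>z k m. Im z > 0 \<Longrightarrow> norm (summand k z) \<le>
    C * (1 + (Re z - b * of_int m)\<^sup>2) * Im z powr (- \<beta>) / (1 + Im z) * weight (k - m)"
proof -
  obtain C where C: "C > 0" "\<And>z k. Im z > 0 \<Longrightarrow>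
    norm (slope k z) \<le> C * Im z powr (- \<beta>) / norm (z - cnj (node k))"
    using slope_bound by metis
  obtain D where D: "D > 0" "\<And>k. norm (target k / deriv F (node k)) \<le> D"
    using target_bounded by metis
  show ?thesis
  proof (rule that[of "8 * C * D"])
    fix z :: complex and k m :: int assume z: "Im z > 0"
    define N where "N = norm (z - cnj (node k))"
    have N: "N > 0" using minus_cnj_node_nonzero[OF z] by (simp add: N_def)
    have "norm (summand k z) = norm (target k / deriv F (node k)) * norm (slope k z) * (2 / N)\<^sup>2"
      by (simp add: summand_def norm_mult norm_divide norm_power N_def)
    also have "\<dots> \<le> D * (C * Im z powr (- \<beta>) / N) * (2 / N)\<^sup>2"
      using C(1) C(2)[OF z] D by (intro mult_mono mult_nonneg_nonneg) (auto simp: N_def)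
    also have "\<dots> = 4 * C * D * Im z powr (- \<beta>) * (1 / N ^ 3)"
      by (simp add: power2_eq_square power3_eq_cube mult_ac)
    also have "\<dots> \<le> 4 * C * D * Im z powr (- \<beta>) *
        (2 * (1 + (Re z - b * of_int m)\<^sup>2) / (1 + Im z) * weight (k - m))"
      unfolding N_def using C D z by (intro mult_left_mono kernel_bound) auto
    also have "\<dots> = 8 * C * D * (1 + (Re z - b * of_int m)\<^sup>2) * Im z powr (- \<beta>) / (1 + Im z) * weight (k - m)"
      by (simp only: times_divide_eq_left times_divide_eq_right mult_ac)
    finally show "norm (summand k z) \<le>
        8 * C * D * (1 + (Re z - b * of_int m)\<^sup>2) * Im z powr (- \<beta>) / (1 + Im z) * weight (k - m)" .
  qed (use C D in auto)
qed

lemma holomorphic_row_interp: "row_interp holomorphic_on uhp"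
  unfolding row_interp_def
proof (rule holomorphic_infsum[OF holomorphic_summand])
  fix z :: complex assume "z \<in> uhp"
  then have z: "Im z > 0" by simp
  define r where "r = Im z / 2"
  have r: "r > 0" using z by (simp add: r_def)
  obtain C where C: "C > 0" "\<And>z k m. Im z > 0 \<Longrightarrow> norm (summand k z) \<le>
    C * (1 + (Re z - b * of_int m)\<^sup>2) * Im z powr (- \<beta>) / (1 + Im z) * weight (k - m)"
    using summand_bound by metis
  define K where "K = C * (1 + (norm z + r)\<^sup>2) * r powr (- \<beta>) / 1"
  have "norm (summand k w) \<le> K * weight k" if w: "w \<in> ball z r" for k w
  proof -
    note wb = half_ball_bounds[OF z w[unfolded r_def], folded r_def]
    have "norm (summand k w) \<le> C * (1 + (Re w)\<^sup>2) * Im w powr (- \<beta>) / (1 + Im w) * weight k"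
      using C(2)[of w k 0] wb(3) by simp
    also have "\<dots> \<le> K * weight k"
      unfolding K_def
    proof (intro mult_right_mono frac_le mult_mono mult_nonneg_nonneg mult_left_mono add_left_mono)
      show "(Re w)\<^sup>2 \<le> (norm z + r)\<^sup>2"
        using wb(2) r by (intro power2_le_iff_abs_le[THEN iffD2]) simp_all
      show "Im w powr (- \<beta>) \<le> r powr (- \<beta>)"
        using wb(1) r beta_pos by (intro powr_mono2') simp_all
    qed (use C(1) wb r weight_pos[of k] in \<open>simp_all add: add_nonneg_nonneg\<close>)
    finally show ?thesis .
  qed
  then show "\<exists>r>0. \<exists>M. ball z r \<subseteq> uhp \<and> M summable_on UNIV \<and>
      (\<forall>k. \<forall>w\<in>ball z r. norm (summand k w) \<le> M k)"
    using r half_ball_subset[OF z, folded r_def] summable_on_cmult_right[OF weight_summable, of K]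
    by blast
qed

lemma row_interp_bound:
  obtains C where "C > 0" "\<And>z. Im z > 0 \<Longrightarrow> norm (row_interp z) \<le> C * Im z powr (- \<beta>) / (1 + Im z)"
proof -
  obtain C where C: "C > 0" "\<And>z k m. Im z > 0 \<Longrightarrow> norm (summand k z) \<le>
    C * (1 + (Re z - b * of_int m)\<^sup>2) * Im z powr (- \<beta>) / (1 + Im z) * weight (k - m)"
    using summand_bound by metis
  define S where "S = (\<Sum>\<^sub>\<infinity>k. weight k)"
  have S: "S \<ge> 0" unfolding S_def by (intro infsum_nonneg less_imp_le weight_pos)
  show ?thesis
  proof (rule that[of "C * (1 + (b / 2)\<^sup>2) * (S + 1)"])
    show "C * (1 + (b / 2)\<^sup>2) * (S + 1) > 0"
      using C(1) S by (intro mult_pos_pos) (simp_all add: add_pos_nonneg)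
    fix z :: complex assume z: "Im z > 0"
    obtain m :: int where m: "\<bar>Re z - b * of_int m\<bar> \<le> b / 2"
      using nearest_node by metis
    define K where "K = C * (1 + (b / 2)\<^sup>2) * Im z powr (- \<beta>) / (1 + Im z)"
    have "norm (summand k z) \<le> K * weight (k - m)" for k
    proof -
      have "(Re z - b * of_int m)\<^sup>2 \<le> (b / 2)\<^sup>2"
        using m b_pos by (intro power2_le_iff_abs_le[THEN iffD2]) simp_all
      then have "C * (1 + (Re z - b * of_int m)\<^sup>2) * Im z powr (- \<beta>) / (1 + Im z) \<le> K"
        unfolding K_def using C(1) z
        by (intro divide_right_mono mult_right_mono mult_left_mono) simp_all
      with C(2)[OF z, of k m] weight_pos[of "k - m"] show ?thesis
        by (meson less_imp_le mult_right_mono order_trans)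
    qed
    moreover have shift: "bij_betw (\<lambda>k. k - m) UNIV UNIV"
      by (rule bij_betw_byWitness[of _ "\<lambda>k. k + m"]) simp_all
    then have "(\<lambda>k. weight (k - m)) summable_on UNIV"
      using weight_summable by (simp only: summable_on_reindex_bij_betw[of _ _ _ weight])
    then have "(\<lambda>k. K * weight (k - m)) summable_on UNIV"
      by (rule summable_on_cmult_right)
    ultimately have "norm (row_interp z) \<le> (\<Sum>\<^sub>\<infinity>k. K * weight (k - m))"
      unfolding row_interp_def by (rule infsum_dominated)
    also have "\<dots> = K * S"
      unfolding infsum_cmult_right' S_def by (simp only: infsum_reindex_bij_betw[OF shift, of weight])
    also have "\<dots> \<le> K * (S + 1)"
      unfolding K_def using C(1) z by (intro mult_left_mono) simp_all
    finally show "norm (row_interp z) \<le> C * (1 + (b / 2)\<^sup>2) * (S + 1) * Im z powr (- \<beta>) / (1 + Im z)"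
      by (simp add: K_def mult_ac)
  qed
qed

lemma node_eq_iff [simp]: "node k = node l \<longleftrightarrow> k = l"
  using b_pos by (simp add: node_def)

lemma row_interp_node: "row_interp (node k) = target k"
proof -
  have "node k - cnj (node k) = 2 * \<i>"
    by (simp add: complex_eq_iff)
  then have "summand k (node k) = target k"
    using deriv_F_node_nonzero by (simp add: summand_def slope_def)
  moreover have "summand l (node k) = 0" if "l \<noteq> k" for l
    using that by (simp add: summand_def slope_def F_node)
  then have "row_interp (node k) = (\<Sum>\<^sub>\<infinity>l\<in>{k}. summand l (node k))"
    unfolding row_interp_def by (intro infsum_cong_neutral) auto
  ultimately show ?thesis by simp
qed

text \<open>Keeps the rows from interfering: the interpolant for height 1 vanishes at the zeros of
  \<open>F\<close> on all other rows.\<close>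

lemma row_interp_eq_0:
  assumes "F z = 0" "Im z \<noteq> 1"
  shows "row_interp z = 0"
proof -
  have "z \<noteq> node k" for k using assms(2) by auto
  then have "summand k z = 0" for k
    using assms by (simp add: summand_def slope_def F_node)
  then show ?thesis by (simp add: row_interp_def)
qed

section \<open>Summation of the row interpolants over all scales\<close>

definition layer :: "int \<Rightarrow> complex \<Rightarrow> complex" where
  "layer j z = of_real a powi (- j) * row_interp (of_real a powi (- j) * z)"

text \<open>\<open>F'' / F'\<close> is homogeneous of degree -1 under multiplication by
  \<open>a\<close>, so the value required at \<open>a powi j * node k\<close> is
  \<open>a powi (- j) * target k\<close>; this is the origin of the prefactor in
  \<open>layer\<close>.\<close>

definition interp :: "complex \<Rightarrow> complex" where
  "interp z = (\<Sum>\<^sub>\<infinity>j. layer j z)"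

text \<open>The bound of \<open>row_interp\<close> after rescaling by
  \<open>t = a powi (- j)\<close>: the prefactor \<open>t\<close> and
  \<open>t powr (- \<beta>) = q powi j\<close> combine to \<open>(q / a) powi j\<close>. Here
  \<open>l\<close> stands for a lower bound of the heights.\<close>

definition layer_weight :: "real \<Rightarrow> int \<Rightarrow> real" where
  "layer_weight l j = (q / a) powi j / (1 + a powi (- j) * l)"

lemma Im_powi_mult: "Im (of_real a powi j * z) = a powi j * Im z"
  by (simp flip: of_real_power_int)

lemma a_powi_pos: "a powi j > 0"
  using a_gt_1 by simp

lemma layer_weight_nonneg: "l > 0 \<Longrightarrow> layer_weight l j \<ge> 0"
  unfolding layer_weight_def using q_gt_1 a_gt_1 a_powi_pos[of "- j"]
  by (intro divide_nonneg_nonneg add_nonneg_nonneg mult_nonneg_nonneg zero_le_power_int) simp_all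

text \<open>Convergence at \<open>j \<longrightarrow> \<infinity>\<close> is where the density hypothesis \<open>q < a\<close> enters.\<close>

lemma layer_weight_summable:
  assumes l: "l > 0"
  shows "layer_weight l summable_on UNIV"
proof (rule summable_on_int)
  show "summable (\<lambda>n. layer_weight l (int n))"
  proof (rule summable_comparison_test')
    show "summable (\<lambda>n. (q / a) ^ n)"
      using q_gt_1 q_less_a by (intro summable_geometric) simp
    fix n :: nat
    have "(q / a) ^ n / (1 + a powi (- int n) * l) \<le> (q / a) ^ n / 1"
      using l q_gt_1 a_gt_1 a_powi_pos[of "- int n"] by (intro divide_left_mono) (simp_all add: add_pos_nonneg)
    then show "norm (layer_weight l (int n)) \<le> (q / a) ^ n"
      unfolding real_norm_def abs_of_nonneg[OF layer_weight_nonneg[OF l]] by (simp add: layer_weight_def)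
  qed
  \<comment> \<open>In this direction the denominator grows like \<open>a ^ n\<close> and leaves the
    ratio \<open>1 / q\<close>; convergence rests on \<open>q > 1\<close>.\<close>
  show "summable (\<lambda>n. layer_weight l (- int n))"
  proof (rule summable_comparison_test')
    show "summable (\<lambda>n. (1 / q) ^ n * (1 / l))"
      using q_gt_1 by (intro summable_mult2 summable_geometric) simp
    fix n :: nat
    have "layer_weight l (- int n) = (a / q) ^ n / (1 + a ^ n * l)"
      by (simp add: layer_weight_def power_int_minus power_divide)
    also have "\<dots> \<le> (a / q) ^ n / (a ^ n * l)"
      using l q_gt_1 a_gt_1 by (intro divide_left_mono) (simp_all add: add_pos_nonneg)
    also have "\<dots> = (1 / q) ^ n * (1 / l)"
      using a_gt_1 by (simp add: power_divide)
    finally show "norm (layer_weight l (- int n)) \<le> (1 / q) ^ n * (1 / l)"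
      using layer_weight_nonneg[OF l, of "- int n"] by simp
  qed
qed (rule layer_weight_nonneg[OF l])

text \<open>Stated with a lower bound \<open>l\<close> for the height, so that one majorant serves a
  whole disc or the whole strip.\<close>

lemma layer_bound:
  obtains C where "C > 0" "\<And>l z j. 0 < l \<Longrightarrow> l \<le> Im z \<Longrightarrow>
    norm (layer j z) \<le> C * l powr (- \<beta>) * layer_weight l j"
proof -
  obtain C where C: "C > 0" "\<And>z. Im z > 0 \<Longrightarrow> norm (row_interp z) \<le> C * Im z powr (- \<beta>) / (1 + Im z)"
    using row_interp_bound by metis
  show ?thesis
  proof (rule that[OF C(1)])
    fix l z j assume l: "0 < l" "l \<le> Im z"
    define t where "t = a powi (- j)"
    have t: "t > 0" unfolding t_def by (rule a_powi_pos)
    have im: "Im (of_real a powi (- j) * z) = t * Im z"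
      unfolding t_def by (rule Im_powi_mult)
    have tb: "t powr (- \<beta>) = q powi j"
    proof -
      have "t powr (- \<beta>) = (a powr \<beta>) powi j"
        using a_gt_1 by (simp add: t_def powr_powr mult_ac flip: powr_real_of_int')
      then show ?thesis by (simp only: a_powr_beta)
    qed
    have "norm (layer j z) = t * norm (row_interp (of_real a powi (- j) * z))"
      using a_gt_1 by (simp add: layer_def t_def norm_mult norm_power_int)
    also have "\<dots> \<le> t * (C * (t * Im z) powr (- \<beta>) / (1 + t * Im z))"
      using C(2)[of "of_real a powi (- j) * z"] t l unfolding im by (intro mult_left_mono) simp_all
    also have "\<dots> \<le> t * (C * (t * l) powr (- \<beta>) / (1 + t * l))"
      using t l C(1) beta_pos
      by (intro mult_left_mono frac_le powr_mono2') (simp_all add: add_pos_pos)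
    also have "\<dots> = C * l powr (- \<beta>) * ((t * q powi j) / (1 + t * l))"
      using t l by (simp add: powr_mult tb mult_ac)
    also have "t * q powi j = (q / a) powi j"
      by (simp add: t_def power_int_minus power_int_divide_distrib field_simps)
    finally show "norm (layer j z) \<le> C * l powr (- \<beta>) * layer_weight l j"
      by (simp add: layer_weight_def t_def)
  qed
qed

lemma holomorphic_layer: "layer j holomorphic_on uhp"
proof -
  have "(\<lambda>z. row_interp (of_real a powi (- j) * z)) holomorphic_on uhp"
  proof (rule holomorphic_on_compose_gen[OF _ holomorphic_row_interp, unfolded o_def])
    show "(\<lambda>z. of_real a powi (- j) * z) ` uhp \<subseteq> uhp"
      using a_powi_pos by (auto simp only: image_subset_iff mem_Collect_eq Im_powi_mult zero_less_mult_iff)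
  qed (intro holomorphic_intros)
  then show ?thesis
    unfolding layer_def by (intro holomorphic_intros)
qed

lemma holomorphic_interp: "interp holomorphic_on uhp"
  unfolding interp_def
proof (rule holomorphic_infsum[OF holomorphic_layer])
  fix z :: complex assume "z \<in> uhp"
  then have z: "Im z > 0" by simp
  define r where "r = Im z / 2"
  have r: "r > 0" using z by (simp add: r_def)
  obtain C where C: "C > 0" "\<And>l z j. 0 < l \<Longrightarrow> l \<le> Im z \<Longrightarrow>
    norm (layer j z) \<le> C * l powr (- \<beta>) * layer_weight l j"
    using layer_bound by metis
  have "norm (layer j w) \<le> C * r powr (- \<beta>) * layer_weight r j" if "w \<in> ball z r" for j w
    by (rule C(2)[OF r half_ball_bounds(1)[OF z that[unfolded r_def], folded r_def]])
  then show "\<exists>r>0. \<exists>M. ball z r \<subseteq> uhp \<and> M summable_on UNIV \<and>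
      (\<forall>j. \<forall>w\<in>ball z r. norm (layer j w) \<le> M j)"
    using r half_ball_subset[OF z, folded r_def]
      summable_on_cmult_right[OF layer_weight_summable[OF r], of "C * r powr (- \<beta>)"]
    by blast
qed

text \<open>A pure index shift in the sum over the scales; it needs no convergence, hence
  \<open>z\<close> is unrestricted.\<close>

lemma interp_scale: "interp (of_real a * z) = (1 / of_real a) * interp z"
proof -
  have "layer (j + 1) (of_real a * z) = (1 / of_real a) * layer j z" for j
  proof -
    have "of_real a powi (- (j + 1)) = (of_real a powi (- j) / of_real a :: complex)"
      using a_gt_1 power_int_add[of "complex_of_real a" "- j" "- 1"] by (simp add: divide_inverse)
    then show ?thesis using a_gt_1 by (simp add: layer_def)
  qed
  moreover have "interp (of_real a * z) = (\<Sum>\<^sub>\<infinity>j. layer (j + 1) (of_real a * z))"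
    unfolding interp_def
    by (rule infsum_reindex_bij_betw[symmetric], rule bij_betw_byWitness[of _ "\<lambda>k. k - 1"]) simp_all
  ultimately show ?thesis
    by (simp only: infsum_cmult_right' interp_def)
qed

lemma growth_interp: "growth 1 interp"
proof -
  obtain C where C: "C > 0" "\<And>l z j. 0 < l \<Longrightarrow> l \<le> Im z \<Longrightarrow>
    norm (layer j z) \<le> C * l powr (- \<beta>) * layer_weight l j"
    using layer_bound by metis
  define l where "l = 1 / sqrt a"
  have l: "l > 0" using a_gt_1 by (simp add: l_def)
  show ?thesis
  proof (rule growth_scaling[OF a_gt_1])
    fix z assume "z \<in> central_strip a"
    then have "l \<le> Im z" by (simp add: central_strip_def l_def)
    then show "norm (interp z) \<le> (\<Sum>\<^sub>\<infinity>j. C * l powr (- \<beta>) * layer_weight l j)"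
      unfolding interp_def
      by (intro infsum_dominated C(2)[OF l] summable_on_cmult_right layer_weight_summable l)
  qed (use a_gt_1 in \<open>simp add: interp_scale norm_mult norm_divide powr_minus inverse_eq_divide\<close>)
qed

lemma interp_node: "interp (node k) = target k"
proof -
  have "layer j (node k) = 0" if "j \<noteq> 0" for j
  proof -
    have "a powi (- j) \<noteq> 1"
      using a_gt_1 that powr_real_of_int'[of a "- j"] powr_eq_one_iff[of a "of_int (- j)"] by simp
    moreover have "F (of_real a powi (- j) * node k) = 0"
      by (simp add: F_scale_powi F_node)
    moreover have "Im (of_real a powi (- j) * node k) = a powi (- j)"
      unfolding Im_powi_mult by simp
    ultimately show ?thesis
      unfolding layer_def by (subst row_interp_eq_0) (simp_all del: times_complex.sel)
  qed
  then have "interp (node k) = (\<Sum>\<^sub>\<infinity>j\<in>{0}. layer j (node k))"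
    unfolding interp_def by (intro infsum_cong_neutral) auto
  then show ?thesis by (simp add: layer_def row_interp_node)
qed

subsection \<open>The differential equation in the half-plane\<close>

definition numer :: "complex \<Rightarrow> complex" where
  "numer z = deriv (deriv F) z + 2 * (deriv F z * interp z)"

lemma holomorphic_deriv_F: "deriv F holomorphic_on uhp"
  by (rule holomorphic_deriv[OF holomorphic_F open_uhp])

lemma holomorphic_numer: "numer holomorphic_on uhp"
  unfolding numer_def
  by (intro holomorphic_intros holomorphic_interp holomorphic_F holomorphic_deriv_F open_uhp)

lemma deriv_F_scale:
  assumes "Im z > 0"
  shows "deriv F (of_real a * z) = - (1 / of_real q) / of_real a * deriv F z"
  using a_gt_1 assms by (intro deriv_scale[OF holomorphic_F _ F_scale]) simp_all

lemma numer_scale: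
  assumes "Im z > 0"
  shows "numer (of_real a * z) = - (1 / of_real q) / of_real a / of_real a * numer z"
proof -
  have "deriv (deriv F) (of_real a * z) = - (1 / of_real q) / of_real a / of_real a * deriv (deriv F) z"
    using a_gt_1 assms by (intro deriv_scale[OF holomorphic_deriv_F _ deriv_F_scale]) simp_all
  then show ?thesis
    by (simp only: numer_def deriv_F_scale[OF assms] interp_scale) (simp add: algebra_simps)
qed

lemma growth_numer: "growth (\<beta> + 1 + 1) numer"
  unfolding numer_def using beta_pos
  by (intro growth_add growth_cmult growth_mult growth_interp growth_deriv growth_F
      holomorphic_F holomorphic_deriv_F) simp_all

lemma numer_node: "numer (node k) = 0"
  using deriv_F_node_nonzero by (simp add: numer_def interp_node target_def)

text \<open>The interpolation condition is checked at height 1 only; self-similarity of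
  \<open>numer\<close> carries it to the other rows.\<close>

lemma numer_eq_0:
  assumes "Im z > 0" "F z = 0"
  shows "numer z = 0"
proof -
  obtain j k where z: "z = of_real a powi j * node k"
    using assms F_eq_0_iff by blast
  have "numer z = (- (1 / of_real q) / of_real a / of_real a) powi j * numer (node k)"
    unfolding z by (rule scaling_powi[of a _ numer, OF _ _ numer_scale]) (use a_gt_1 q_gt_1 in simp_all)
  then show ?thesis by (simp add: numer_node)
qed

definition quot :: "complex \<Rightarrow> complex" where
  "quot = zero_quotient numer F"

lemma holomorphic_quot: "quot holomorphic_on uhp"
  unfolding quot_def
  by (rule holomorphic_zero_quotient[OF open_uhp holomorphic_numer holomorphic_F])
     (use numer_eq_0 deriv_F_nonzero in simp)

lemma F_times_quot: "Im z > 0 \<Longrightarrow> F z * quot z = numer z"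
  by (simp add: quot_def zero_quotient_def numer_eq_0)

lemma quot_scale:
  assumes "Im z > 0"
  shows "quot (of_real a * z) = 1 / (of_real a)\<^sup>2 * quot z"
proof -
  have "deriv numer (of_real a * z) = - (1 / of_real q) / of_real a / of_real a / of_real a * deriv numer z"
    using a_gt_1 assms by (intro deriv_scale[OF holomorphic_numer _ numer_scale]) simp_all
  then show ?thesis
    using a_gt_1 q_gt_1
    by (simp add: quot_def zero_quotient_def F_scale[OF assms] numer_scale[OF assms]
        deriv_F_scale[OF assms] power2_eq_square)
qed

text \<open>By self-similarity a bound in the strip is enough. Off the zeros, compare with the
  nearest node: \<open>numer\<close> is at most, and \<open>F\<close> at least, a constant times the
  distance to it, and the distance cancels. At a node the quotient is a ratio of
  derivatives.\<close>

lemma growth_quot: "growth 2 quot"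
proof -
  obtain C where C: "C > 0" "\<And>z w. z \<in> central_strip a \<Longrightarrow> w \<in> central_strip a \<Longrightarrow>
      norm (numer z - numer w) \<le> C * norm (z - w)"
    using growth_lipschitz_central_strip[OF a_gt_1 growth_numer holomorphic_numer] beta_pos
    by (smt (verit))
  obtain c where c: "c > 0" "\<And>z k. z \<in> central_strip a \<Longrightarrow> \<bar>Re z - b * of_int k\<bar> \<le> b / 2 \<Longrightarrow>
     c * norm (z - node k) \<le> norm (F z)"
    using F_lower_bound by metis
  have nonneg: "\<beta> + 1 + 1 \<ge> 0" using beta_pos by simp
  obtain D where D: "D > 0" "\<And>z. z \<in> central_strip a \<Longrightarrow> norm (deriv numer z) \<le> D"
    using growth_bounded_central_strip[OF a_gt_1 growth_deriv[OF growth_numer holomorphic_numer nonneg]]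
    by metis
  obtain d where d: "d > 0" "\<And>k. d \<le> norm (deriv F (node k))"
    using deriv_F_node_lower_bound by metis
  show ?thesis
  proof (rule growth_scaling[OF a_gt_1])
    fix z assume z: "z \<in> central_strip a"
    show "norm (quot z) \<le> max (D / d) (C / c)"
    proof (cases "F z = 0")
      case True
      then obtain k where k: "z = node k" using F_zero_in_strip[OF z] by metis
      have "norm (quot z) = norm (deriv numer z) / norm (deriv F z)"
        using True by (simp add: quot_def zero_quotient_def norm_divide)
      also have "\<dots> \<le> D / d"
        by (rule frac_le) (use D(1) D(2)[OF z] d(1) d(2)[of k] k in simp_all)
      finally show ?thesis by simp
    next
      case False
      obtain k :: int where k: "\<bar>Re z - b * of_int k\<bar> \<le> b / 2"
        using nearest_node by metis
      have n: "norm (z - node k) > 0"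
        using False F_node by auto
      have "norm (quot z) = norm (numer z) / norm (F z)"
        using False by (simp add: quot_def zero_quotient_def norm_divide)
      also have "\<dots> \<le> (C * norm (z - node k)) / (c * norm (z - node k))"
        by (rule frac_le) (use C(1) C(2)[OF z node_in_strip[of k]] c(1) c(2)[OF z k] n in
            \<open>simp_all add: numer_node\<close>)
      also have "\<dots> = C / c" using n by simp
      finally show ?thesis by simp
    qed
  next
    fix z assume z: "Im z > 0"
    have "a powr (- 2) = 1 / a\<^sup>2"
      using a_gt_1 by (simp add: powr_minus inverse_eq_divide)
    then show "norm (quot (of_real a * z)) = a powr (- 2) * norm (quot z)"
      using a_gt_1 by (simp add: quot_scale[OF z] norm_mult norm_divide norm_power)
  qed
qed

text \<open>The sign is written as a multiplication by \<open>- 1\<close> to fit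
  \<open>growth_cmult\<close>.\<close>

definition potential :: "complex \<Rightarrow> complex" where
  "potential z = - 1 * (quot z + (deriv interp z + interp z * interp z))"

lemma holomorphic_potential: "potential holomorphic_on uhp"
  unfolding potential_def
  by (intro holomorphic_intros holomorphic_quot holomorphic_interp open_uhp)

lemma growth_potential: "growth 2 potential"
proof -
  have "growth (1 + 1) (deriv interp)" "growth (1 + 1) (\<lambda>z. interp z * interp z)"
    by (intro growth_deriv growth_mult growth_interp holomorphic_interp; simp)+
  then show ?thesis
    unfolding potential_def by (intro growth_cmult growth_add growth_quot) simp_all
qed

lemma halfplane_solution:
  obtains u where "u holomorphic_on uhp"
    "\<And>z. Im z > 0 \<Longrightarrow> deriv (deriv u) z + potential z * u z = 0"
    "\<And>z. Im z > 0 \<Longrightarrow> u z = 0 \<longleftrightarrow> (\<exists>j k. z = of_real a powi j * node k)"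
    "\<And>z. Im z > 0 \<Longrightarrow> u z = 0 \<Longrightarrow> deriv u z \<noteq> 0"
proof -
  obtain g where "\<And>z. z \<in> uhp \<Longrightarrow> (g has_field_derivative interp z) (at z within uhp)"
    using holomorphic_convex_primitive'[OF convex_uhp open_uhp holomorphic_interp] by metis
  then have g: "(g has_field_derivative interp z) (at z)" if "Im z > 0" for z
    using that by (simp add: at_within_open[OF _ open_uhp])
  \<comment> \<open>The exponential has no zeros, so \<open>u\<close> inherits the zeros of
    \<open>F\<close>; at such a point \<open>u'\<close> reduces to
    \<open>deriv F z * exp (g z)\<close>, so they stay simple.\<close>
  define u where "u = (\<lambda>z. F z * exp (g z))"
  define u' where "u' = (\<lambda>z. (deriv F z + F z * interp z) * exp (g z))"
  have F: "(F has_field_derivative deriv F z) (at z)"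
    "(deriv F has_field_derivative deriv (deriv F) z) (at z)"
    "(interp has_field_derivative deriv interp z) (at z)" if "Im z > 0" for z
    using that by (auto intro!: holomorphic_derivI[OF _ open_uhp] holomorphic_F holomorphic_deriv_F holomorphic_interp)
  have u: "(u has_field_derivative u' z) (at z)" if "Im z > 0" for z
    unfolding u_def u'_def
    by (rule derivative_eq_intros F[OF that] g[OF that] refl)+ (simp add: algebra_simps)
  have du: "deriv u z = u' z" if "Im z > 0" for z
    by (rule DERIV_imp_deriv[OF u[OF that]])
  have u'': "(u' has_field_derivative - potential z * u z) (at z)" if "Im z > 0" for z
    unfolding u'_def
  proof (rule derivative_eq_intros F[OF that] g[OF that] refl)+
    have fq: "F z * quot z = deriv (deriv F) z + 2 * (deriv F z * interp z)"
      by (simp add: F_times_quot[OF that] numer_def)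
    have "- potential z * u z = (F z * quot z + F z * (deriv interp z + interp z * interp z)) * exp (g z)"
      by (simp add: potential_def u_def algebra_simps)
    then show "(deriv (deriv F) z + (deriv F z * interp z + deriv interp z * F z)) * exp (g z) +
        exp (g z) * interp z * (deriv F z + F z * interp z) = - potential z * u z"
      by (simp only: fq) (simp add: algebra_simps)
  qed
  show ?thesis
  proof (rule that[of u])
    show "u holomorphic_on uhp"
      using u by (auto simp: holomorphic_on_open[OF open_uhp])
    fix z assume z: "Im z > 0"
    have "(deriv u has_field_derivative - potential z * u z) (at z)"
      by (rule has_field_derivative_transform_within_open[OF u''[OF z] open_uhp]) (use z du in simp_all)
    then show "deriv (deriv u) z + potential z * u z = 0"
      by (simp add: DERIV_imp_deriv)
    show "u z = 0 \<longleftrightarrow> (\<exists>j k. z = of_real a powi j * node k)"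
      using F_eq_0_iff[OF z] by (simp add: u_def)
    assume "u z = 0"
    then have "F z = 0" by (simp add: u_def)
    then show "deriv u z \<noteq> 0"
      using deriv_F_nonzero[OF z] unfolding du[OF z] by (simp add: u'_def)
  qed
qed

end

subsection \<open>Transfer to the disc\<close>

definition inv_cayley :: "complex \<Rightarrow> complex" where
  "inv_cayley z = \<i> * (1 + z) / (1 - z)"

lemma disc_ne_1: "z \<in> unit_disc \<Longrightarrow> 1 - z \<noteq> 0"
  by auto

lemma Im_inv_cayley:
  assumes "z \<noteq> 1"
  shows "Im (inv_cayley z) = (1 - (norm z)\<^sup>2) / (norm (1 - z))\<^sup>2"
proof -
  have "inv_cayley z = \<i> * (1 + z) * cnj (1 - z) / of_real ((norm (1 - z))\<^sup>2)"
    using assms complex_norm_square[of "1 - z"] by (simp add: inv_cayley_def divide_simps)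
  also have "Im \<dots> = (1 - (norm z)\<^sup>2) / (norm (1 - z))\<^sup>2"
    unfolding Im_divide_of_real cmod_power2[of z] by (simp add: power2_eq_square algebra_simps)
  finally show ?thesis .
qed

lemma Im_inv_cayley_pos:
  assumes "z \<in> unit_disc"
  shows "Im (inv_cayley z) > 0"
proof -
  have "(norm z)\<^sup>2 < 1" using assms by (simp add: power_less_one_iff)
  then show ?thesis
    using disc_ne_1[OF assms] by (subst Im_inv_cayley) (auto intro!: divide_pos_pos)
qed

lemma cayley_inv_cayley: "z \<noteq> 1 \<Longrightarrow> cayley (inv_cayley z) = z"
  by (simp add: cayley_def inv_cayley_def divide_simps) (simp add: algebra_simps)

lemma plus_i_nonzero: "Im w > 0 \<Longrightarrow> w + \<i> \<noteq> 0"
  by (auto simp: complex_eq_iff)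

lemma inv_cayley_cayley: "Im w > 0 \<Longrightarrow> inv_cayley (cayley w) = w"
  using plus_i_nonzero[of w]
  by (simp add: cayley_def inv_cayley_def divide_simps)

lemma one_minus_norm_cayley_square:
  assumes "Im w > 0"
  shows "1 - (norm (cayley w))\<^sup>2 = 4 * Im w / (norm (w + \<i>))\<^sup>2"
proof -
  have "(norm (w + \<i>))\<^sup>2 - (norm (w - \<i>))\<^sup>2 = 4 * Im w"
    unfolding cmod_power2 by (simp add: power2_eq_square algebra_simps)
  moreover have "(norm (cayley w))\<^sup>2 = (norm (w - \<i>))\<^sup>2 / (norm (w + \<i>))\<^sup>2"
    by (simp add: cayley_def norm_divide power_divide)
  then have "1 - (norm (cayley w))\<^sup>2 = ((norm (w + \<i>))\<^sup>2 - (norm (w - \<i>))\<^sup>2) / (norm (w + \<i>))\<^sup>2"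
    using plus_i_nonzero[OF assms] by (simp add: diff_divide_distrib)
  ultimately show ?thesis by simp
qed

lemma cayley_in_disc:
  assumes "Im w > 0"
  shows "cayley w \<in> unit_disc"
proof -
  have "4 * Im w / (norm (w + \<i>))\<^sup>2 > 0"
    using assms plus_i_nonzero[OF assms] by simp
  then have "(norm (cayley w))\<^sup>2 < 1"
    using one_minus_norm_cayley_square[OF assms] by linarith
  then show ?thesis by (simp add: power_less_one_iff abs_square_less_1)
qed

lemma inv_cayley_deriv:
  "z \<noteq> 1 \<Longrightarrow> (inv_cayley has_field_derivative 2 * \<i> / (1 - z)\<^sup>2) (at z)"
  unfolding inv_cayley_def
  by (auto intro!: derivative_eq_intros simp: divide_simps power2_eq_square) (simp add: algebra_simps)

text \<open>The factor \<open>1 - z\<close> is, up to a constant, the reciprocal square root of the derivative of the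
  conformal map; it removes the first-order term from the transformed equation.\<close>

lemma transfer_to_disc:
  assumes u: "u holomorphic_on uhp"
    and ode: "\<And>z. Im z > 0 \<Longrightarrow> deriv (deriv u) z + B z * u z = 0"
    and B: "B holomorphic_on uhp" "growth 2 B"
  defines "f \<equiv> \<lambda>z. (1 - z) * u (inv_cayley z)"
    and "A \<equiv> \<lambda>z. - 4 * B (inv_cayley z) / (1 - z) ^ 4"
  shows "A \<in> H_inf_2" "solves_ode A f"
    "\<And>z. z \<in> unit_disc \<Longrightarrow> u (inv_cayley z) = 0 \<Longrightarrow> deriv u (inv_cayley z) \<noteq> 0 \<Longrightarrow> deriv f z \<noteq> 0"
proof -
  \<comment> \<open>The square of this derivative, \<open>- 4 / (1 - z) ^ 4\<close>, is the factor
    in \<open>A\<close>. No further term arises, since a Moebius map has vanishing Schwarzian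
    derivative.\<close>
  have T: "(inv_cayley has_field_derivative 2 * \<i> / (1 - z)\<^sup>2) (at z)" if "z \<in> unit_disc" for z
    using that by (intro inv_cayley_deriv) auto
  then have holT: "inv_cayley holomorphic_on unit_disc"
    unfolding holomorphic_on_open[OF open_ball] by blast
  have img: "inv_cayley ` unit_disc \<subseteq> uhp"
    using Im_inv_cayley_pos by blast
  have "(\<lambda>z. B (inv_cayley z)) holomorphic_on unit_disc"
    using holomorphic_on_compose_gen[OF holT B(1) img] by (simp add: o_def)
  then have holA: "A holomorphic_on unit_disc"
    unfolding A_def by (intro holomorphic_intros) auto
  obtain C where C: "C > 0" "\<And>z. Im z > 0 \<Longrightarrow> norm (B z) \<le> C * Im z powr (- 2)"
    using growthE[OF B(2)] by metis
  have "(1 - (norm z)\<^sup>2)\<^sup>2 * norm (A z) \<le> 4 * C" if z: "z \<in> unit_disc" for z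
  proof -
    define y where "y = Im (inv_cayley z)"
    define d where "d = norm (1 - z)"
    have y: "y > 0" unfolding y_def by (rule Im_inv_cayley_pos[OF z])
    have d: "d > 0" using disc_ne_1[OF z] by (simp add: d_def)
    have "1 - (norm z)\<^sup>2 = y * d\<^sup>2"
      using Im_inv_cayley[of z] disc_ne_1[OF z] d by (auto simp: y_def d_def)
    then have "(1 - (norm z)\<^sup>2)\<^sup>2 * norm (A z) = (y * d\<^sup>2)\<^sup>2 * (4 * norm (B (inv_cayley z)) / d ^ 4)"
      by (simp add: A_def norm_mult norm_divide norm_power d_def)
    also have "\<dots> = 4 * y\<^sup>2 * norm (B (inv_cayley z))"
      using d by (simp add: power2_eq_square power4_eq_xxxx)
    also have "\<dots> \<le> 4 * y\<^sup>2 * (C * y powr (- 2))"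
      using C(2)[of "inv_cayley z"] y by (intro mult_left_mono) (simp_all add: y_def)
    also have "\<dots> = 4 * C"
      using y by (simp add: powr_minus)
    finally show ?thesis .
  qed
  then show "A \<in> H_inf_2"
    using holA unfolding H_inf_2_def by (auto intro!: bdd_aboveI)
  have up: "(u has_field_derivative deriv u w) (at w)"
    "(deriv u has_field_derivative deriv (deriv u) w) (at w)" if "Im w > 0" for w
    using that by (auto intro!: holomorphic_derivI[OF _ open_uhp] u holomorphic_deriv[OF u open_uhp])
  define f' where "f' = (\<lambda>z. - u (inv_cayley z) + 2 * \<i> / (1 - z) * deriv u (inv_cayley z))"
  have uT: "((\<lambda>z. u (inv_cayley z)) has_field_derivative deriv u (inv_cayley z) * (2 * \<i> / (1 - z)\<^sup>2)) (at z)"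
    "((\<lambda>z. deriv u (inv_cayley z)) has_field_derivative
      deriv (deriv u) (inv_cayley z) * (2 * \<i> / (1 - z)\<^sup>2)) (at z)" if "z \<in> unit_disc" for z
    by (rule DERIV_chain2[where g = inv_cayley, OF _ T[OF that]], rule up, rule Im_inv_cayley_pos[OF that])+
  have f: "(f has_field_derivative f' z) (at z)" if z: "z \<in> unit_disc" for z
    unfolding f_def f'_def
    using disc_ne_1[OF z]
    by (auto intro!: derivative_eq_intros uT[OF z] simp: divide_simps power2_eq_square)
  have f': "(f' has_field_derivative - A z * f z) (at z)" if z: "z \<in> unit_disc" for z
  proof -
    define v where "v = 1 - z"
    have v: "v \<noteq> 0" using disc_ne_1[OF z] by (simp add: v_def)
    have 1: "deriv (deriv u) (inv_cayley z) = - (B (inv_cayley z) * u (inv_cayley z))"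
      using ode[OF Im_inv_cayley_pos[OF z]] by (simp add: eq_neg_iff_add_eq_0)
    have "((\<lambda>z. 2 * \<i> / (1 - z)) has_field_derivative 2 * \<i> / v\<^sup>2) (at z)"
      using v by (auto intro!: derivative_eq_intros simp: v_def power2_eq_square)
    from DERIV_add[OF DERIV_minus[OF uT(1)[OF z]] DERIV_mult[OF this uT(2)[OF z]]]
    have "(f' has_field_derivative - (deriv u (inv_cayley z) * (2 * \<i> / v\<^sup>2)) +
        (2 * \<i> / v\<^sup>2 * deriv u (inv_cayley z) + deriv (deriv u) (inv_cayley z) * (2 * \<i> / v\<^sup>2) * (2 * \<i> / v)))
        (at z)"
      by (simp add: f'_def v_def)
    \<comment> \<open>The two terms with \<open>deriv u\<close> cancel, which is the effect of the
      factor \<open>1 - z\<close> in \<open>f\<close>.\<close>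
    also have "- (deriv u (inv_cayley z) * (2 * \<i> / v\<^sup>2)) +
        (2 * \<i> / v\<^sup>2 * deriv u (inv_cayley z) + deriv (deriv u) (inv_cayley z) * (2 * \<i> / v\<^sup>2) * (2 * \<i> / v))
        = - A z * f z"
      unfolding 1 A_def f_def v_def[symmetric] using v
      by (simp add: divide_simps power2_eq_square power4_eq_xxxx)
    finally show ?thesis .
  qed
  have df: "deriv f z = f' z" if "z \<in> unit_disc" for z
    by (rule DERIV_imp_deriv[OF f[OF that]])
  have "(deriv ^^ 2) f z + A z * f z = 0" if z: "z \<in> unit_disc" for z
  proof -
    have "(deriv f has_field_derivative - A z * f z) (at z)"
      by (rule has_field_derivative_transform_within_open[OF f'[OF z] open_ball z]) (simp add: df)
    then show ?thesis
      by (simp add: numeral_2_eq_2 DERIV_imp_deriv)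
  qed
  moreover have "f holomorphic_on unit_disc"
    using f unfolding holomorphic_on_open[OF open_ball] by blast
  ultimately show "solves_ode A f"
    unfolding solves_ode_def by blast
  fix z assume z: "z \<in> unit_disc" and "u (inv_cayley z) = 0" "deriv u (inv_cayley z) \<noteq> 0"
  then show "deriv f z \<noteq> 0"
    using disc_ne_1[OF z] unfolding df[OF z] by (simp add: f'_def)
qed

lemma zero_mult_simple:
  assumes "f holomorphic_on unit_disc" "w \<in> unit_disc" "f w = 0" "deriv f w \<noteq> 0"
  shows "zero_mult f w = 1"
proof -
  have "zorder f w = 1"
    by (rule zorder_zero_eqI[OF assms(1) open_ball assms(2)]) (use assms(3,4) in simp_all)
  then show ?thesis using assms(3) by (simp add: zero_mult_def)
qed

section \<open>The zero-sequence in the disc and its divergent Blaschke sum\<close>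

context cayley_lattice
begin

definition lattice_point :: "int \<Rightarrow> int \<Rightarrow> complex" where
  "lattice_point j k = of_real a powi j * node k"

lemma Im_lattice_point: "Im (lattice_point j k) = a powi j"
  unfolding lattice_point_def Im_powi_mult by simp

lemma Im_lattice_point_pos: "Im (lattice_point j k) > 0"
  by (simp add: Im_lattice_point a_powi_pos)

lemma Lambda_eq: "Lambda a b = range (\<lambda>(j, k). cayley (lattice_point j k))"
  by (auto simp: Lambda_def lattice_point_def node_def image_def)

text \<open>The height determines \<open>j\<close>, and then the point determines \<open>k\<close>.
  This makes enumerations without repetition possible and lets the Blaschke sum be counted by index
  pairs.\<close>

lemma inj_cayley_lattice_point: "inj (\<lambda>(j, k). cayley (lattice_point j k))"
proof (rule injI, clarify)
  fix j k j' k' assume "cayley (lattice_point j k) = cayley (lattice_point j' k')"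
  then have eq: "lattice_point j k = lattice_point j' k'"
    using inv_cayley_cayley[OF Im_lattice_point_pos] by metis
  then have "a powi j = a powi j'" using Im_lattice_point by metis
  then have "a powr (of_int j) = a powr (of_int j')"
    using a_gt_1 by (simp add: powr_real_of_int')
  then have "j = j'" using a_gt_1 by (simp add: powr_inj)
  with eq show "j = j' \<and> k = k'"
    using a_gt_1 by (simp add: lattice_point_def)
qed

lemma Lambda_subset: "Lambda a b \<subseteq> unit_disc"
  unfolding Lambda_eq using cayley_in_disc[OF Im_lattice_point_pos] by fastforce

lemma ex_bij_betw_Lambda: "\<exists>zs :: nat \<Rightarrow> complex. bij_betw zs UNIV (Lambda a b)"
proof -
  have "countable (Lambda a b)" unfolding Lambda_eq by simp
  moreover have "infinite (Lambda a b)"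
    unfolding Lambda_eq using inj_cayley_lattice_point
    by (simp add: finite_image_iff finite_prod)
  ultimately show ?thesis using bij_betw_from_nat_into by blast
qed

text \<open>For these \<open>k\<close> the point has real part in \<open>[0, b]\<close> and height
  at most 1, so its squared distance to \<open>- \<i>\<close> is at most \<open>b^2 + 4\<close>. The
  bound follows from \<open>one_minus_norm_cayley_square\<close> and
  \<open>1 - x^2 \<le> 2 * (1 - x)\<close>.\<close>

lemma lattice_point_depth:
  assumes "0 \<le> k" "of_int k \<le> a ^ m"
  shows "2 / (b\<^sup>2 + 4) / a ^ m \<le> 1 - norm (cayley (lattice_point (- int m) k))"
proof -
  define w where "w = lattice_point (- int m) k"
  define t where "t = a powi (- int m)"
  have t: "t > 0" "t = 1 / a ^ m"
    using a_gt_1 by (simp_all add: t_def power_int_minus inverse_eq_divide)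
  have t1: "t \<le> 1" using t a_gt_1 by (simp add: one_le_power)
  have im: "Im w = t" by (simp add: w_def Im_lattice_point t_def)
  have w: "Im w > 0" using im t by simp
  have "w = of_real t * node k"
    by (simp add: w_def lattice_point_def t_def)
  then have re: "Re w = b * (t * of_int k)" by simp
  have "t * of_int k \<le> 1" using assms(2) t a_gt_1 by simp
  then have "b * (t * of_int k) \<le> b * 1" using b_pos by (intro mult_left_mono) simp_all
  moreover have "Re w \<ge> 0" using re b_pos t(1) assms(1) by simp
  ultimately have "(Re w)\<^sup>2 \<le> b\<^sup>2" using re by (intro power_mono) simp_all
  moreover have "(Im w + 1)\<^sup>2 \<le> 2\<^sup>2" using im t t1 by (intro power_mono) simp_all
  ultimately have n: "(norm (w + \<i>))\<^sup>2 \<le> b\<^sup>2 + 4"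
    unfolding cmod_power2 by simp
  define x where "x = norm (cayley w)"
  have x: "0 \<le> x" "x < 1" using cayley_in_disc[OF w] by (simp_all add: x_def)
  have "4 * t / (b\<^sup>2 + 4) \<le> 4 * Im w / (norm (w + \<i>))\<^sup>2"
    unfolding im using n t plus_i_nonzero[OF w] by (intro divide_left_mono mult_pos_pos) (simp_all add: add_nonneg_pos)
  also have "\<dots> = (1 - x) * (1 + x)"
    unfolding one_minus_norm_cayley_square[OF w, symmetric] x_def
    by (simp add: power2_eq_square algebra_simps)
  also have "\<dots> \<le> (1 - x) * 2"
    using x by (intro mult_left_mono) simp_all
  finally have "2 * t / (b\<^sup>2 + 4) \<le> 1 - x" by simp
  then show ?thesis by (simp add: x_def w_def t(2) mult.commute)
qed

text \<open>At scale \<open>a powi (- m)\<close> at least \<open>a ^ m\<close> points each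
  contribute at least \<epsilon>\<open>/ a ^ m\<close>, so every scale contributes at least
  \<epsilon>. The order of \<open>zs\<close> does not matter, and repetitions only increase the
  sum.\<close>

lemma not_Blaschke:
  assumes disc: "range zs \<subseteq> unit_disc" and cover: "Lambda a b \<subseteq> range zs"
  shows "\<not> Blaschke_condition zs"
proof
  assume "Blaschke_condition zs"
  then have sm: "summable (\<lambda>n. 1 - norm (zs n))" by (simp add: Blaschke_condition_def)
  have nonneg: "0 \<le> 1 - norm (zs n)" for n
    using disc by (auto simp: image_subset_iff less_imp_le)
  define S where "S = (\<Sum>n. 1 - norm (zs n))"
  define p where "p = (\<lambda>(m, k). cayley (lattice_point (- int m) k))"
  \<comment> \<open>Selects one occurrence of each lattice point in \<open>zs\<close>; distinct
    points have distinct indices, so partial sums over points become partial sums over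
    indices.\<close>
  define ix where "ix = (\<lambda>mk. inv zs (p mk))"
  have zs_ix: "zs (ix mk) = p mk" for mk
  proof -
    have "p mk \<in> Lambda a b" unfolding Lambda_eq p_def by (cases mk) auto
    then show ?thesis using cover by (auto simp: ix_def intro: f_inv_into_f)
  qed
  have inj: "inj_on ix X" for X
  proof (rule inj_onI)
    fix x y assume "ix x = ix y"
    then have "p x = p y" using zs_ix by metis
    then have "(- int (fst x), snd x) = (- int (fst y), snd y)"
      using injD[OF inj_cayley_lattice_point, of "(- int (fst x), snd x)" "(- int (fst y), snd y)"]
      by (simp add: p_def split_beta)
    then show "x = y" by (simp add: prod_eq_iff)
  qed
  define \<epsilon> where "\<epsilon> = 2 / (b\<^sup>2 + 4)"
  have e: "\<epsilon> > 0" by (simp add: \<epsilon>_def add_nonneg_pos)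
  have layer: "\<epsilon> \<le> (\<Sum>k\<in>{0..\<lfloor>a ^ m\<rfloor>}. 1 - norm (p (m, k)))" for m
  proof -
    have am: "a ^ m > 0" using a_gt_1 by simp
    have "\<epsilon> = a ^ m * (\<epsilon> / a ^ m)" using a_gt_1 by simp
    also have "\<dots> \<le> of_nat (card {0..\<lfloor>a ^ m\<rfloor>}) * (\<epsilon> / a ^ m)"
    proof (rule mult_right_mono)
      have "\<lfloor>a ^ m\<rfloor> \<ge> 0" using am by simp
      then have "real (card {0..\<lfloor>a ^ m\<rfloor>}) = of_int (\<lfloor>a ^ m\<rfloor> + 1)" by simp
      then show "a ^ m \<le> real (card {0..\<lfloor>a ^ m\<rfloor>})" by linarith
    qed (use e am in simp)
    also have "\<dots> \<le> (\<Sum>k\<in>{0..\<lfloor>a ^ m\<rfloor>}. 1 - norm (p (m, k)))"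
    proof (rule sum_bounded_below)
      fix k assume "k \<in> {0..\<lfloor>a ^ m\<rfloor>}"
      then show "\<epsilon> / a ^ m \<le> 1 - norm (p (m, k))"
        unfolding p_def \<epsilon>_def prod.case by (intro lattice_point_depth) (simp_all add: le_floor_iff)
    qed
    finally show ?thesis .
  qed
  have bound: "real M * \<epsilon> \<le> S" for M
  proof -
    define X where "X = (SIGMA m:{..<M}. {0..\<lfloor>a ^ m\<rfloor>})"
    have "real M * \<epsilon> = (\<Sum>m<M. \<epsilon>)" by simp
    also have "\<dots> \<le> (\<Sum>m<M. \<Sum>k\<in>{0..\<lfloor>a ^ m\<rfloor>}. 1 - norm (p (m, k)))"
      by (intro sum_mono layer)
    also have "\<dots> = (\<Sum>mk\<in>X. 1 - norm (p mk))"
      unfolding X_def by (subst sum.Sigma) (simp_all add: split_beta)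
    also have "\<dots> = (\<Sum>n\<in>ix ` X. 1 - norm (zs n))"
      by (simp add: sum.reindex[OF inj] zs_ix)
    also have "\<dots> \<le> S"
      unfolding S_def using nonneg by (intro sum_le_suminf sm) (simp_all add: X_def)
    finally show ?thesis .
  qed
  obtain M :: nat where "S / \<epsilon> < real M" using reals_Archimedean2 by blast
  with bound[of M] e show False by (simp add: pos_divide_less_eq)
qed

lemma ex_solution_with_zeros_Lambda:
  "\<exists>A\<in>H_inf_2. \<exists>f. solves_ode A f \<and> nontrivial f \<and>
    (\<exists>zs. bij_betw zs UNIV (Lambda a b) \<and> is_zero_sequence f zs) \<and>
    (\<forall>zs. is_zero_sequence f zs \<longrightarrow> \<not> Blaschke_condition zs)"
proof -
  obtain u where u: "u holomorphic_on uhp"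
    "\<And>z. Im z > 0 \<Longrightarrow> deriv (deriv u) z + potential z * u z = 0"
    "\<And>z. Im z > 0 \<Longrightarrow> u z = 0 \<longleftrightarrow> (\<exists>j k. z = of_real a powi j * node k)"
    "\<And>z. Im z > 0 \<Longrightarrow> u z = 0 \<Longrightarrow> deriv u z \<noteq> 0"
    using halfplane_solution by metis
  define f where "f = (\<lambda>z. (1 - z) * u (inv_cayley z))"
  define A where "A = (\<lambda>z. - 4 * potential (inv_cayley z) / (1 - z) ^ 4)"
  have transfer: "A \<in> H_inf_2" "solves_ode A f"
    "\<And>z. z \<in> unit_disc \<Longrightarrow> u (inv_cayley z) = 0 \<Longrightarrow> deriv u (inv_cayley z) \<noteq> 0 \<Longrightarrow> deriv f z \<noteq> 0"
    unfolding f_def A_def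
    by (rule transfer_to_disc[OF u(1) _ holomorphic_potential growth_potential]; use u(2) in simp)+
  have hol: "f holomorphic_on unit_disc"
    using transfer(2) by (simp add: solves_ode_def)
  have f0: "f z = 0 \<longleftrightarrow> u (inv_cayley z) = 0" if "z \<in> unit_disc" for z
    using disc_ne_1[OF that] by (simp add: f_def)
  have df: "deriv f z \<noteq> 0" if "z \<in> unit_disc" "f z = 0" for z
    using transfer(3)[OF that(1)] u(4)[OF Im_inv_cayley_pos[OF that(1)]] f0[OF that(1)] that(2) by blast
  have zeros: "f z = 0 \<longleftrightarrow> z \<in> Lambda a b" if z: "z \<in> unit_disc" for z
  proof -
    have "inv_cayley z = lattice_point j k \<longleftrightarrow> z = cayley (lattice_point j k)" for j k
    proof
      assume "inv_cayley z = lattice_point j k"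
      then show "z = cayley (lattice_point j k)"
        using cayley_inv_cayley[of z] disc_ne_1[OF z] by simp
    next
      assume "z = cayley (lattice_point j k)"
      then show "inv_cayley z = lattice_point j k"
        by (simp only: inv_cayley_cayley[OF Im_lattice_point_pos])
    qed
    then show ?thesis
      unfolding f0[OF z] u(3)[OF Im_inv_cayley_pos[OF z]] Lambda_eq lattice_point_def[symmetric]
      by (auto simp: image_def)
  qed
  have mult: "zero_mult f w = (if w \<in> Lambda a b then 1 else 0)" if "w \<in> unit_disc" for w
    using zero_mult_simple[OF hol that _ df[OF that]] zeros[OF that] by (simp add: zero_mult_def)
  have "nontrivial f"
  \<comment> \<open>Were \<open>f\<close> identically zero, the origin would be a zero with
    vanishing derivative, contrary to the simplicity of the zeros.\<close>
  proof (rule ccontr)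
    assume "\<not> nontrivial f"
    then have f: "f z = 0" if "z \<in> unit_disc" for z
      using that by (auto simp: nontrivial_def)
    have "(f has_field_derivative 0) (at 0)"
      by (rule has_field_derivative_transform_within_open[of "\<lambda>_. 0" _ _ unit_disc]) (simp_all add: f)
    then show False using df[of 0] f[of 0] by (simp add: DERIV_imp_deriv)
  qed
  moreover have "is_zero_sequence f zs" if zs: "bij_betw zs UNIV (Lambda a b)" for zs
    unfolding is_zero_sequence_def
  proof (intro conjI ballI)
    have r: "range zs = Lambda a b" using zs by (simp add: bij_betw_def)
    show "range zs \<subseteq> unit_disc" using r Lambda_subset by simp
    fix w assume w: "w \<in> unit_disc"
    have "{n. zs n = w} = (if w \<in> Lambda a b then {inv zs w} else {})"
    proof (cases "w \<in> Lambda a b")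
      case True
      then have "w \<in> range zs" using r by simp
      moreover have "inj zs" using zs by (simp add: bij_betw_def)
      ultimately show ?thesis using True by (auto simp: inv_f_f inj_eq)
    qed (use r in auto)
    then show "finite {n. zs n = w}" "card {n. zs n = w} = zero_mult f w"
      using mult[OF w] by simp_all
  qed
  moreover have "\<not> Blaschke_condition zs" if zs: "is_zero_sequence f zs" for zs
  proof (rule not_Blaschke)
    show "range zs \<subseteq> unit_disc" using zs by (simp add: is_zero_sequence_def)
    show "Lambda a b \<subseteq> range zs"
    proof
      fix w assume w: "w \<in> Lambda a b"
      then have "card {n. zs n = w} = 1"
        using zs mult Lambda_subset by (auto simp: is_zero_sequence_def)
      then have "{n. zs n = w} \<noteq> {}" by (metis card.empty zero_neq_one)
      then show "w \<in> range zs" by auto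
    qed
  qed
  ultimately show ?thesis
    using transfer(1,2) ex_bij_betw_Lambda by blast
qed

end

theorem corollary2:
  fixes a b :: real
  assumes "a > 1" and "b > 0" and "2 * pi / (b * ln a) < 1"
  shows "\<exists>A\<in>H_inf_2. \<exists>f. solves_ode A f \<and> nontrivial f \<and>
    (\<exists>zs. bij_betw zs UNIV (Lambda a b) \<and> is_zero_sequence f zs) \<and>
    (\<forall>zs. is_zero_sequence f zs \<longrightarrow> \<not> Blaschke_condition zs)"
proof -
  have "2 * pi / b < ln a"
    using assms by (simp add: divide_less_eq mult.commute)
  then have "exp (2 * pi / b) < a"
    using assms(1) by (metis exp_less_cancel_iff exp_ln less_trans zero_less_one)
  then interpret cayley_lattice a b
    using assms by unfold_locales
  show ?thesis by (rule ex_solution_with_zeros_Lambda)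
qed

end
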